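(* Let $R$ be a commutative Artinian principal ideal ring and let $M$ be an $R$-module. Then: (1) $M$ is bi-Hopfian if and only if $M$ is finitely generated. (2) $M$ is bi-Hopfian if and only if its injective envelope $E(M)$ is bi-Hopfian.
   Context: All rings have $1 \neq 0$ and all modules are unital. A principal ideal ring is a ring (not necessarily a domain) in which every ideal is principal. An $R$-module $M$ is Hopfian if every surjective $R$-module endomorphism of $M$ is an isomorphism, co-Hopfian if every injective $R$-module endomorphism of $M$ is an isomorphism, and bi-Hopfian if it is both Hopfian and co-Hopfian. *)

theory Defs
  imports "HOL-Algebra.Algebra"
begin

locale principal_ideal_cring = cring +
  assumes every_ideal_principal: "ideal I R \<Longrightarrow> principalideal I R"

locale artinian_cring = cring +
  assumes descending_chain_stabilises:
    "\<lbrakk>\<And>n::nat. ideal (I n) R; \<And>n. I (Suc n) \<subseteq> I n\<rbrakk> \<Longrightarrow> \<exists>n. \<forall>m\<ge>n. I m = I n"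

definition mod_hom ::
    "('a, 'm) ring_scheme \<Rightarrow> ('a, 'b, 'n) module_scheme \<Rightarrow> ('a, 'c, 'k) module_scheme
      \<Rightarrow> ('b \<Rightarrow> 'c) set"
  where "mod_hom R M N =
    {f \<in> carrier M \<rightarrow> carrier N.
      (\<forall>x\<in>carrier M. \<forall>y\<in>carrier M. f (x \<oplus>\<^bsub>M\<^esub> y) = f x \<oplus>\<^bsub>N\<^esub> f y) \<and>
      (\<forall>r\<in>carrier R. \<forall>x\<in>carrier M. f (r \<odot>\<^bsub>M\<^esub> x) = r \<odot>\<^bsub>N\<^esub> f x)}"

definition mod_iso ::
    "('a, 'm) ring_scheme \<Rightarrow> ('a, 'b, 'n) module_scheme \<Rightarrow> ('a, 'c, 'k) module_scheme
      \<Rightarrow> ('b \<Rightarrow> 'c) set"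
  where "mod_iso R M N = {f \<in> mod_hom R M N. bij_betw f (carrier M) (carrier N)}"

definition hopfian :: "('a, 'm) ring_scheme \<Rightarrow> ('a, 'b, 'n) module_scheme \<Rightarrow> bool"
  where "hopfian R M \<longleftrightarrow>
    (\<forall>f\<in>mod_hom R M M. f ` carrier M = carrier M \<longrightarrow> f \<in> mod_iso R M M)"

definition co_hopfian :: "('a, 'm) ring_scheme \<Rightarrow> ('a, 'b, 'n) module_scheme \<Rightarrow> bool"
  where "co_hopfian R M \<longleftrightarrow>
    (\<forall>f\<in>mod_hom R M M. inj_on f (carrier M) \<longrightarrow> f \<in> mod_iso R M M)"

definition bi_hopfian :: "('a, 'm) ring_scheme \<Rightarrow> ('a, 'b, 'n) module_scheme \<Rightarrow> bool"
  where "bi_hopfian R M \<longleftrightarrow> hopfian R M \<and> co_hopfian R M"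

definition finitely_generated :: "('a, 'm) ring_scheme \<Rightarrow> ('a, 'b, 'n) module_scheme \<Rightarrow> bool"
  where "finitely_generated R M \<longleftrightarrow>
    (\<exists>S. finite S \<and> S \<subseteq> carrier M \<and> (\<lambda>N. submodule N R M) hull S = carrier M)"

text \<open>Injectivity against all monomorphisms between modules whose elements are of type
  \<^typ>\<open>'c\<close>. A definition in HOL cannot quantify over \<^typ>\<open>'c\<close>.\<close>

definition injective_wrt ::
    "'c itself \<Rightarrow> ('a, 'm) ring_scheme \<Rightarrow> ('a, 'e, 'n) module_scheme \<Rightarrow> bool"
  where "injective_wrt T R E \<longleftrightarrow> module R E \<and>
    (\<forall>(A :: ('a, 'c) module) (B :: ('a, 'c) module) f g.
      module R A \<and> module R B \<and>
      f \<in> mod_hom R A B \<and> inj_on f (carrier A) \<and> g \<in> mod_hom R A E \<longrightarrow>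
      (\<exists>h\<in>mod_hom R B E. \<forall>x\<in>carrier A. h (f x) = g x))"

text \<open>The test modules range over the type of the ring elements. By Baer's argument this gives
  injectivity against test modules of every type: see \<open>injective_module_imp_injective_wrt\<close>.\<close>

definition injective_module ::
    "('a, 'm) ring_scheme \<Rightarrow> ('a, 'e, 'n) module_scheme \<Rightarrow> bool"
  where "injective_module R E \<longleftrightarrow> injective_wrt TYPE('a) R E"

lemma injective_module_imp_injective_wrt:
  fixes R :: "('a, 'm) ring_scheme" and E :: "('a, 'e, 'n) module_scheme"
  assumes "injective_module R E"
  shows "injective_wrt TYPE('c) R E"
proof -
  have inj: "module R E"
    "\<And>(A :: ('a, 'a) module) (B :: ('a, 'a) module) f g.
      module R A \<Longrightarrow> module R B \<Longrightarrow> f \<in> mod_hom R A B \<Longrightarrow> inj_on f (carrier A) \<Longrightarrow> g \<in> mod_hom R A E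
      \<Longrightarrow> \<exists>h\<in>mod_hom R B E. \<forall>x\<in>carrier A. h (f x) = g x"
    using assms unfolding injective_module_def injective_wrt_def by blast+
  interpret E: module R E by (rule inj(1))
  have "\<exists>h\<in>mod_hom R B E. \<forall>x\<in>carrier A. h (f x) = g x"
    if mA: "module R A" and mB: "module R B" and f: "f \<in> mod_hom R A B"
      and fi: "inj_on f (carrier A)" and g: "g \<in> mod_hom R A E"
    for A B :: "('a, 'c) module" and f g
  proof -
    interpret A: module R A by (rule mA)
    interpret B: module R B by (rule mB)
    define base where "base = (\<lambda>a. (f a, g a)) ` carrier A"
    define P where "P G \<longleftrightarrow> G \<subseteq> carrier B \<times> carrier E \<and> base \<subseteq> G \<and>
      (\<forall>x y x' y'. (x, y) \<in> G \<longrightarrow> (x', y') \<in> G \<longrightarrow> (x \<oplus>\<^bsub>B\<^esub> x', y \<oplus>\<^bsub>E\<^esub> y') \<in> G) \<and>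
      (\<forall>r\<in>carrier R. \<forall>x y. (x, y) \<in> G \<longrightarrow> (r \<odot>\<^bsub>B\<^esub> x, r \<odot>\<^bsub>E\<^esub> y) \<in> G) \<and>
      (\<forall>y. (\<zero>\<^bsub>B\<^esub>, y) \<in> G \<longrightarrow> y = \<zero>\<^bsub>E\<^esub>)" for G
    have f0: "f \<zero>\<^bsub>A\<^esub> = \<zero>\<^bsub>B\<^esub>" and g0: "g \<zero>\<^bsub>A\<^esub> = \<zero>\<^bsub>E\<^esub>"
    proof -
      have "f (\<zero>\<^bsub>R\<^esub> \<odot>\<^bsub>A\<^esub> \<zero>\<^bsub>A\<^esub>) = \<zero>\<^bsub>R\<^esub> \<odot>\<^bsub>B\<^esub> f \<zero>\<^bsub>A\<^esub>" "f \<zero>\<^bsub>A\<^esub> \<in> carrier B"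
        using f unfolding mod_hom_def by (blast intro: E.R.zero_closed A.M.zero_closed)+
      then show "f \<zero>\<^bsub>A\<^esub> = \<zero>\<^bsub>B\<^esub>" by simp
      have "g (\<zero>\<^bsub>R\<^esub> \<odot>\<^bsub>A\<^esub> \<zero>\<^bsub>A\<^esub>) = \<zero>\<^bsub>R\<^esub> \<odot>\<^bsub>E\<^esub> g \<zero>\<^bsub>A\<^esub>" "g \<zero>\<^bsub>A\<^esub> \<in> carrier E"
        using g unfolding mod_hom_def by (blast intro: E.R.zero_closed A.M.zero_closed)+
      then show "g \<zero>\<^bsub>A\<^esub> = \<zero>\<^bsub>E\<^esub>" by simp
    qed
    have fadd: "f (x \<oplus>\<^bsub>A\<^esub> y) = f x \<oplus>\<^bsub>B\<^esub> f y" "g (x \<oplus>\<^bsub>A\<^esub> y) = g x \<oplus>\<^bsub>E\<^esub> g y"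
      if "x \<in> carrier A" "y \<in> carrier A" for x y
      using f g that unfolding mod_hom_def by blast+
    have fsm: "f (r \<odot>\<^bsub>A\<^esub> x) = r \<odot>\<^bsub>B\<^esub> f x" "g (r \<odot>\<^bsub>A\<^esub> x) = r \<odot>\<^bsub>E\<^esub> g x"
      if "r \<in> carrier R" "x \<in> carrier A" for r x
      using f g that unfolding mod_hom_def by blast+
    have fcl: "f x \<in> carrier B" "g x \<in> carrier E" if "x \<in> carrier A" for x
      using f g that unfolding mod_hom_def by blast+
    have "P base"
      unfolding P_def
    proof (intro conjI allI ballI impI)
      show "base \<subseteq> carrier B \<times> carrier E" "base \<subseteq> base" unfolding base_def using fcl by auto
    next
      fix x y x' y' assume "(x, y) \<in> base" "(x', y') \<in> base"
      then obtain a a' where *: "a \<in> carrier A" "a' \<in> carrier A" "x = f a" "y = g a" "x' = f a'" "y' = g a'"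
        unfolding base_def by auto
      then have "(x \<oplus>\<^bsub>B\<^esub> x', y \<oplus>\<^bsub>E\<^esub> y') = (f (a \<oplus>\<^bsub>A\<^esub> a'), g (a \<oplus>\<^bsub>A\<^esub> a'))" by (simp add: fadd)
      with * show "(x \<oplus>\<^bsub>B\<^esub> x', y \<oplus>\<^bsub>E\<^esub> y') \<in> base" unfolding base_def by auto
    next
      fix r x y assume r: "r \<in> carrier R" and "(x, y) \<in> base"
      then obtain a where *: "a \<in> carrier A" "x = f a" "y = g a"
        unfolding base_def by auto
      then have "(r \<odot>\<^bsub>B\<^esub> x, r \<odot>\<^bsub>E\<^esub> y) = (f (r \<odot>\<^bsub>A\<^esub> a), g (r \<odot>\<^bsub>A\<^esub> a))" using r by (simp add: fsm)
      with * r show "(r \<odot>\<^bsub>B\<^esub> x, r \<odot>\<^bsub>E\<^esub> y) \<in> base" unfolding base_def by auto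
    next
      fix y assume "(\<zero>\<^bsub>B\<^esub>, y) \<in> base"
      then obtain a where *: "a \<in> carrier A" "f a = \<zero>\<^bsub>B\<^esub>" "y = g a"
        unfolding base_def by auto
      then have "a = \<zero>\<^bsub>A\<^esub>" using fi f0 by (metis inj_onD A.M.zero_closed)
      then show "y = \<zero>\<^bsub>E\<^esub>" using * g0 by simp
    qed
    have "\<exists>G\<in>Collect P. \<forall>H\<in>Collect P. G \<subseteq> H \<longrightarrow> H = G"
    proof (rule subset_Zorn_nonempty)
      show "Collect P \<noteq> {}" using \<open>P base\<close> by auto
      fix C assume C: "C \<noteq> {}" "subset.chain (Collect P) C"
      have CP: "P G" if "G \<in> C" for G using C that unfolding subset_chain_def by auto
      have tot: "\<exists>G\<in>C. p \<in> G \<and> q \<in> G" if "p \<in> \<Union>C" "q \<in> \<Union>C" for p q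
        using C that unfolding subset_chain_def by blast
      have "P (\<Union>C)"
        unfolding P_def
      proof (intro conjI allI ballI impI)
        show "\<Union>C \<subseteq> carrier B \<times> carrier E" using CP unfolding P_def by blast
        show "base \<subseteq> \<Union>C" using C(1) CP unfolding P_def by blast
      next
        fix x y x' y' assume "(x, y) \<in> \<Union>C" "(x', y') \<in> \<Union>C"
        from tot[OF this] obtain G where "G \<in> C" "(x, y) \<in> G" "(x', y') \<in> G" by blast
        then show "(x \<oplus>\<^bsub>B\<^esub> x', y \<oplus>\<^bsub>E\<^esub> y') \<in> \<Union>C" using CP[of G] unfolding P_def by blast
      next
        fix r x y assume "r \<in> carrier R" "(x, y) \<in> \<Union>C"
        then show "(r \<odot>\<^bsub>B\<^esub> x, r \<odot>\<^bsub>E\<^esub> y) \<in> \<Union>C" using CP unfolding P_def by blast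
      next
        fix y assume "(\<zero>\<^bsub>B\<^esub>, y) \<in> \<Union>C"
        then show "y = \<zero>\<^bsub>E\<^esub>" using CP unfolding P_def by blast
      qed
      then show "\<Union>C \<in> Collect P" by simp
    qed
    then obtain G where PG: "P G" and max: "\<And>H. P H \<Longrightarrow> G \<subseteq> H \<Longrightarrow> H = G" by auto
    have Gc: "x \<in> carrier B" "y \<in> carrier E" if "(x, y) \<in> G" for x y
      using PG that unfolding P_def by blast+
    have Gb: "base \<subseteq> G" using PG unfolding P_def by blast
    have Ga: "(x \<oplus>\<^bsub>B\<^esub> x', y \<oplus>\<^bsub>E\<^esub> y') \<in> G" if "(x, y) \<in> G" "(x', y') \<in> G" for x y x' y'
      using PG that unfolding P_def by blast
    have Gs: "(r \<odot>\<^bsub>B\<^esub> x, r \<odot>\<^bsub>E\<^esub> y) \<in> G" if "r \<in> carrier R" "(x, y) \<in> G" for r x y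
      using PG that unfolding P_def by blast
    have Gz: "y = \<zero>\<^bsub>E\<^esub>" if "(\<zero>\<^bsub>B\<^esub>, y) \<in> G" for y
      using PG that unfolding P_def by blast
    have Gm: "(\<ominus>\<^bsub>B\<^esub> x, \<ominus>\<^bsub>E\<^esub> y) \<in> G" if "(x, y) \<in> G" for x y
      using Gs[of "\<ominus>\<^bsub>R\<^esub> \<one>\<^bsub>R\<^esub>" x y] Gc[OF that] that
      by (simp add: B.smult_l_minus E.smult_l_minus)
    have G0: "(\<zero>\<^bsub>B\<^esub>, \<zero>\<^bsub>E\<^esub>) \<in> G"
      using Gb f0 g0 A.M.zero_closed unfolding base_def by force
    have Gu: "y = y'" if "(x, y) \<in> G" "(x, y') \<in> G" for x y y'
    proof -
      have "y \<oplus>\<^bsub>E\<^esub> \<ominus>\<^bsub>E\<^esub> y' = \<zero>\<^bsub>E\<^esub>"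
        using Ga[OF that(1) Gm[OF that(2)]] Gc[OF that(1)] by (intro Gz) (simp add: B.M.r_neg)
      then show ?thesis using Gc[OF that(1)] Gc[OF that(2)]
        by (metis E.M.minus_equality E.M.minus_minus E.M.a_inv_closed)
    qed
    have dom: "\<exists>y. (b, y) \<in> G" if b: "b \<in> carrier B" for b
    proof -
      define RM :: "('a, 'a) module" where "RM = \<lparr>carrier = carrier R, monoid.mult = monoid.mult R, one = one R,
        ring.zero = ring.zero R, ring.add = ring.add R, module.smult = monoid.mult R\<rparr>"
      have RMab: "abelian_group RM"
      proof (rule abelian_groupI)
        fix x assume "x \<in> carrier RM"
        then show "\<exists>y\<in>carrier RM. y \<oplus>\<^bsub>RM\<^esub> x = \<zero>\<^bsub>RM\<^esub>"
          unfolding RM_def by (auto intro!: bexI[of _ "\<ominus>\<^bsub>R\<^esub> x"] simp: E.R.l_neg)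
      qed (auto simp: RM_def E.R.a_ac)
      have RM: "module R RM"
        by (rule moduleI[OF module.axioms(1)[OF inj(1)] RMab])
          (auto simp: RM_def E.R.l_distr E.R.r_distr E.R.m_assoc)
      define I where "I = {r \<in> carrier R. \<exists>y. (r \<odot>\<^bsub>B\<^esub> b, y) \<in> G}"
      have "submodule I R RM"
      proof (rule module.submoduleI[OF RM])
        show "I \<subseteq> carrier RM" unfolding I_def RM_def by auto
        show "\<zero>\<^bsub>RM\<^esub> \<in> I" unfolding I_def RM_def using G0 b by auto
        have add: "r \<oplus>\<^bsub>R\<^esub> s \<in> I" if "r \<in> I" "s \<in> I" for r s
          using that Ga b unfolding I_def by (auto simp: B.smult_l_distr, blast)
        then show "\<And>r s. r \<in> I \<Longrightarrow> s \<in> I \<Longrightarrow> r \<oplus>\<^bsub>RM\<^esub> s \<in> I" unfolding RM_def by simp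
        have sm: "s \<otimes>\<^bsub>R\<^esub> r \<in> I" if "s \<in> carrier R" "r \<in> I" for r s
          using that Gs b unfolding I_def by (auto simp: B.smult_assoc1)
        then show "\<And>s r. s \<in> carrier R \<Longrightarrow> r \<in> I \<Longrightarrow> s \<odot>\<^bsub>RM\<^esub> r \<in> I" unfolding RM_def by simp
        fix r assume r: "r \<in> I"
        then have rc: "r \<in> carrier R" unfolding I_def by simp
        then have "\<ominus>\<^bsub>R\<^esub> r = (\<ominus>\<^bsub>R\<^esub> \<one>\<^bsub>R\<^esub>) \<otimes>\<^bsub>R\<^esub> r" by (simp add: E.R.l_minus)
        moreover have "\<ominus>\<^bsub>RM\<^esub> r = \<ominus>\<^bsub>R\<^esub> r"
          by (rule abelian_group.minus_equality[OF RMab]) (use rc in \<open>simp_all add: RM_def E.R.l_neg\<close>)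
        ultimately show "\<ominus>\<^bsub>RM\<^esub> r \<in> I" using sm[OF _ r] by simp
      qed
      then have mI: "module R (RM\<lparr>carrier := I\<rparr>)"
        by (rule submodule.submodule_is_module[OF _ RM])
      define \<phi> where "\<phi> r = (THE y. (r \<odot>\<^bsub>B\<^esub> b, y) \<in> G)" for r
      have \<phi>eq: "\<phi> r = y" if "(r \<odot>\<^bsub>B\<^esub> b, y) \<in> G" for r y
        unfolding \<phi>_def using that Gu by (blast intro: the_equality)
      have \<phi>G: "(r \<odot>\<^bsub>B\<^esub> b, \<phi> r) \<in> G" if "r \<in> I" for r
        using that \<phi>eq unfolding I_def by auto
      have Ic: "r \<in> carrier R" if "r \<in> I" for r using that unfolding I_def by auto
      have "\<phi> \<in> mod_hom R (RM\<lparr>carrier := I\<rparr>) E"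
        unfolding mod_hom_def
      proof (intro CollectI conjI ballI)
        show "\<phi> \<in> carrier (RM\<lparr>carrier := I\<rparr>) \<rightarrow> carrier E" using Gc(2)[OF \<phi>G] by auto
      next
        fix r s assume "r \<in> carrier (RM\<lparr>carrier := I\<rparr>)" "s \<in> carrier (RM\<lparr>carrier := I\<rparr>)"
        then have rs: "r \<in> I" "s \<in> I" by auto
        have "\<phi> (r \<oplus>\<^bsub>R\<^esub> s) = \<phi> r \<oplus>\<^bsub>E\<^esub> \<phi> s"
          using Ga[OF \<phi>G[OF rs(1)] \<phi>G[OF rs(2)]] Ic[OF rs(1)] Ic[OF rs(2)] b
          by (intro \<phi>eq) (simp add: B.smult_l_distr)
        then show "\<phi> (r \<oplus>\<^bsub>RM\<lparr>carrier := I\<rparr>\<^esub> s) = \<phi> r \<oplus>\<^bsub>E\<^esub> \<phi> s" by (simp add: RM_def)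
      next
        fix s r assume s: "s \<in> carrier R" and "r \<in> carrier (RM\<lparr>carrier := I\<rparr>)"
        then have r: "r \<in> I" by auto
        have "\<phi> (s \<otimes>\<^bsub>R\<^esub> r) = s \<odot>\<^bsub>E\<^esub> \<phi> r"
          using Gs[OF s \<phi>G[OF r]] Ic[OF r] s b
          by (intro \<phi>eq) (simp add: B.smult_assoc1)
        then show "\<phi> (s \<odot>\<^bsub>RM\<lparr>carrier := I\<rparr>\<^esub> r) = s \<odot>\<^bsub>E\<^esub> \<phi> r" by (simp add: RM_def)
      qed
      moreover have "id \<in> mod_hom R (RM\<lparr>carrier := I\<rparr>) RM"
        unfolding mod_hom_def using Ic by (auto simp: RM_def)
      ultimately obtain h where h: "h \<in> mod_hom R RM E" "\<And>r. r \<in> I \<Longrightarrow> h r = \<phi> r"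
        using inj(2)[OF mI RM, of id \<phi>] by auto
      define e where "e = h \<one>\<^bsub>R\<^esub>"
      have ec: "e \<in> carrier E" using h(1) unfolding e_def mod_hom_def RM_def by auto
      have he: "\<phi> r = r \<odot>\<^bsub>E\<^esub> e" if "r \<in> I" for r
      proof -
        have "h (r \<odot>\<^bsub>RM\<^esub> \<one>\<^bsub>R\<^esub>) = r \<odot>\<^bsub>E\<^esub> h \<one>\<^bsub>R\<^esub>"
          using h(1) Ic[OF that] E.R.one_closed unfolding mod_hom_def RM_def
          by (simp del: E.R.r_one)
        then show ?thesis using h(2)[OF that] Ic[OF that] unfolding e_def by (simp add: RM_def)
      qed
      define G' where "G' = {(x \<oplus>\<^bsub>B\<^esub> r \<odot>\<^bsub>B\<^esub> b, y \<oplus>\<^bsub>E\<^esub> r \<odot>\<^bsub>E\<^esub> e) | x y r. (x, y) \<in> G \<and> r \<in> carrier R}"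
      have G'I: "(x \<oplus>\<^bsub>B\<^esub> r \<odot>\<^bsub>B\<^esub> b, y \<oplus>\<^bsub>E\<^esub> r \<odot>\<^bsub>E\<^esub> e) \<in> G'" if "(x, y) \<in> G" "r \<in> carrier R" for x y r
        unfolding G'_def using that by blast
      have GG': "G \<subseteq> G'"
      proof
        fix p assume "p \<in> G"
        then obtain x y where p: "p = (x, y)" "(x, y) \<in> G" by (cases p) auto
        show "p \<in> G'" using G'I[OF p(2) E.R.zero_closed] Gc[OF p(2)] p(1) b ec by simp
      qed
      have "P G'"
        unfolding P_def
      proof (intro conjI allI ballI impI)
        show "G' \<subseteq> carrier B \<times> carrier E" unfolding G'_def using Gc b ec by auto
        show "base \<subseteq> G'" using Gb GG' by blast
      next
        fix x y x' y' assume "(x, y) \<in> G'" "(x', y') \<in> G'"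
        then obtain u v r u' v' r' where
          *: "(u, v) \<in> G" "r \<in> carrier R" "x = u \<oplus>\<^bsub>B\<^esub> r \<odot>\<^bsub>B\<^esub> b" "y = v \<oplus>\<^bsub>E\<^esub> r \<odot>\<^bsub>E\<^esub> e"
            "(u', v') \<in> G" "r' \<in> carrier R" "x' = u' \<oplus>\<^bsub>B\<^esub> r' \<odot>\<^bsub>B\<^esub> b" "y' = v' \<oplus>\<^bsub>E\<^esub> r' \<odot>\<^bsub>E\<^esub> e"
          unfolding G'_def by auto
        have "x \<oplus>\<^bsub>B\<^esub> x' = (u \<oplus>\<^bsub>B\<^esub> u') \<oplus>\<^bsub>B\<^esub> (r \<oplus>\<^bsub>R\<^esub> r') \<odot>\<^bsub>B\<^esub> b"
          using * b Gc by (simp add: B.smult_l_distr B.M.a_ac)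
        moreover have "y \<oplus>\<^bsub>E\<^esub> y' = (v \<oplus>\<^bsub>E\<^esub> v') \<oplus>\<^bsub>E\<^esub> (r \<oplus>\<^bsub>R\<^esub> r') \<odot>\<^bsub>E\<^esub> e"
          using * ec Gc by (simp add: E.smult_l_distr E.M.a_ac)
        ultimately show "(x \<oplus>\<^bsub>B\<^esub> x', y \<oplus>\<^bsub>E\<^esub> y') \<in> G'"
          using G'I[OF Ga[OF *(1) *(5)], of "r \<oplus>\<^bsub>R\<^esub> r'"] * by simp
      next
        fix s x y assume s: "s \<in> carrier R" and "(x, y) \<in> G'"
        then obtain u v r where
          *: "(u, v) \<in> G" "r \<in> carrier R" "x = u \<oplus>\<^bsub>B\<^esub> r \<odot>\<^bsub>B\<^esub> b" "y = v \<oplus>\<^bsub>E\<^esub> r \<odot>\<^bsub>E\<^esub> e"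
          unfolding G'_def by auto
        have "s \<odot>\<^bsub>B\<^esub> x = s \<odot>\<^bsub>B\<^esub> u \<oplus>\<^bsub>B\<^esub> (s \<otimes>\<^bsub>R\<^esub> r) \<odot>\<^bsub>B\<^esub> b"
          using * b s Gc by (simp add: B.smult_r_distr B.smult_assoc1)
        moreover have "s \<odot>\<^bsub>E\<^esub> y = s \<odot>\<^bsub>E\<^esub> v \<oplus>\<^bsub>E\<^esub> (s \<otimes>\<^bsub>R\<^esub> r) \<odot>\<^bsub>E\<^esub> e"
          using * ec s Gc by (simp add: E.smult_r_distr E.smult_assoc1)
        ultimately show "(s \<odot>\<^bsub>B\<^esub> x, s \<odot>\<^bsub>E\<^esub> y) \<in> G'"
          using G'I[OF Gs[OF s *(1)], of "s \<otimes>\<^bsub>R\<^esub> r"] * s by simp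
      next
        fix y assume "(\<zero>\<^bsub>B\<^esub>, y) \<in> G'"
        then obtain u v r where
          *: "(u, v) \<in> G" "r \<in> carrier R" "\<zero>\<^bsub>B\<^esub> = u \<oplus>\<^bsub>B\<^esub> r \<odot>\<^bsub>B\<^esub> b" "y = v \<oplus>\<^bsub>E\<^esub> r \<odot>\<^bsub>E\<^esub> e"
          unfolding G'_def by auto
        have "r \<odot>\<^bsub>B\<^esub> b = \<ominus>\<^bsub>B\<^esub> u"
          using * Gc(1)[OF *(1)] b
          by (metis B.M.minus_equality B.M.a_comm B.smult_closed)
        then have rG: "(r \<odot>\<^bsub>B\<^esub> b, \<ominus>\<^bsub>E\<^esub> v) \<in> G" using Gm[OF *(1)] by simp
        then have "r \<in> I" unfolding I_def using *(2) by blast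
        then have "r \<odot>\<^bsub>E\<^esub> e = \<ominus>\<^bsub>E\<^esub> v" using he \<phi>eq[OF rG] by simp
        then show "y = \<zero>\<^bsub>E\<^esub>" using *(4) Gc(2)[OF *(1)] by (simp add: E.M.r_neg)
      qed
      then have "G' = G" using max GG' by blast
      moreover have "(b, e) \<in> G'" using G'I[OF G0 E.R.one_closed] b ec by simp
      ultimately show ?thesis by blast
    qed
    define h where "h x = (THE y. (x, y) \<in> G)" for x
    have heq: "h x = y" if "(x, y) \<in> G" for x y
      unfolding h_def using that Gu by (blast intro: the_equality)
    have hG: "(x, h x) \<in> G" if "x \<in> carrier B" for x
      using dom[OF that] heq by auto
    have "h \<in> mod_hom R B E"
      unfolding mod_hom_def using Gc(2)[OF hG] heq[OF Ga[OF hG hG]] heq[OF Gs[OF _ hG]] by auto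
    moreover have "h (f x) = g x" if "x \<in> carrier A" for x
      using that Gb by (intro heq) (auto simp: base_def)
    ultimately show ?thesis by blast
  qed
  then show ?thesis unfolding injective_wrt_def using inj(1) by blast
qed

definition essential_embedding ::
    "('a, 'm) ring_scheme \<Rightarrow> ('a, 'b, 'n) module_scheme \<Rightarrow> ('a, 'e, 'k) module_scheme
      \<Rightarrow> ('b \<Rightarrow> 'e) \<Rightarrow> bool"
  where "essential_embedding R M E \<iota> \<longleftrightarrow>
    \<iota> \<in> mod_hom R M E \<and> inj_on \<iota> (carrier M) \<and>
    (\<forall>N. submodule N R E \<and> N \<noteq> {\<zero>\<^bsub>E\<^esub>} \<longrightarrow> N \<inter> \<iota> ` carrier M \<noteq> {\<zero>\<^bsub>E\<^esub>})"

definition injective_envelope ::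
    "('a, 'm) ring_scheme \<Rightarrow> ('a, 'b, 'n) module_scheme \<Rightarrow> ('a, 'e, 'k) module_scheme
      \<Rightarrow> ('b \<Rightarrow> 'e) \<Rightarrow> bool"
  where "injective_envelope R M E \<iota> \<longleftrightarrow>
    injective_module R E \<and> essential_embedding R M E \<iota>"

end

theory Submission
  imports Defs
begin

text \<open>
  Submodules of finitely generated modules over an Artinian principal ideal ring are finitely
  generated, and finitely generated modules satisfy both chain conditions, hence are bi-Hopfian.

  For the converse, \<open>0\<close> is a product of generators \<open>p\<close> of maximal ideals, so \<open>M\<close> is finitely
  generated as soon as every \<open>ker p = {x. p x = 0}\<close> is. If some \<open>ker p\<close> is not, filter it by
  \<open>V\<^sub>i = p\<^sup>i M \<inter> ker p\<close>. As \<open>p\<^sup>n \<in> (p\<^sup>n\<^sup>+\<^sup>1)\<close> for some \<open>n\<close>, we have \<open>V\<^sub>n = 0\<close>, so for some \<open>i\<close> the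
  quotient of \<open>V\<^sub>i\<close> by \<open>V\<^sub>i\<^sub>+\<^sub>1\<close> is infinite-dimensional over \<open>R/(p)\<close>.
  Lifting an independent sequence of it along \<open>p\<^sup>i\<close> gives a submodule \<open>C\<close> that is free of
  countable rank over \<open>R/(p\<^sup>i\<^sup>+\<^sup>1)\<close> and meets \<open>p\<^sup>i\<^sup>+\<^sup>1 M\<close> trivially. Such a \<open>C\<close> is a direct
  summand of \<open>M\<close>, and the backward shift on \<open>C\<close> extends to a surjective endomorphism of \<open>M\<close> that
  is not injective.

  For the injective envelope, essentiality forces \<open>ker p\<close> to be the same in \<open>E\<close> as in \<open>M\<close>, so the
  same criterion shows that \<open>E\<close> is finitely generated if and only if \<open>M\<close> is.
\<close>

subsection \<open>Finitely generated submodules\<close>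

lemma mod_homD:
  assumes "f \<in> mod_hom R M N"
  shows "x \<in> carrier M \<Longrightarrow> f x \<in> carrier N"
    and "x \<in> carrier M \<Longrightarrow> y \<in> carrier M \<Longrightarrow> f (x \<oplus>\<^bsub>M\<^esub> y) = f x \<oplus>\<^bsub>N\<^esub> f y"
    and "r \<in> carrier R \<Longrightarrow> x \<in> carrier M \<Longrightarrow> f (r \<odot>\<^bsub>M\<^esub> x) = r \<odot>\<^bsub>N\<^esub> f x"
  using assms unfolding mod_hom_def by auto

lemma mod_hom_funpow: "f \<in> mod_hom R M M \<Longrightarrow> f ^^ n \<in> mod_hom R M M"
  by (induction n) (auto simp: mod_hom_def Pi_iff)

context module
begin

lemma mod_hom_zero:
  assumes "module R N" "f \<in> mod_hom R M N"
  shows "f \<zero>\<^bsub>M\<^esub> = \<zero>\<^bsub>N\<^esub>"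
proof -
  interpret N: module R N by fact
  have "f (\<zero> \<odot>\<^bsub>M\<^esub> \<zero>\<^bsub>M\<^esub>) = \<zero> \<odot>\<^bsub>N\<^esub> f \<zero>\<^bsub>M\<^esub>"
    by (rule mod_homD(3)[OF assms(2)]) auto
  then show ?thesis using mod_homD(1)[OF assms(2), of "\<zero>\<^bsub>M\<^esub>"] by simp
qed

lemma mod_hom_minus:
  assumes "module R N" "f \<in> mod_hom R M N" "x \<in> carrier M" "y \<in> carrier M"
  shows "f (x \<ominus>\<^bsub>M\<^esub> y) = f x \<ominus>\<^bsub>N\<^esub> f y"
proof -
  interpret N: module R N by fact
  have "f ((\<ominus> \<one>) \<odot>\<^bsub>M\<^esub> y) = (\<ominus> \<one>) \<odot>\<^bsub>N\<^esub> f y"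
    by (rule mod_homD(3)[OF assms(2)]) (use assms in auto)
  then show ?thesis
    using assms(3,4) mod_homD(1,2)[OF assms(2)]
    by (simp add: smult_l_minus N.smult_l_minus M.minus_eq N.M.minus_eq)
qed

text \<open>Negatives need no separate check, since they arise by scaling with
  \<open>\<ominus> \<one>\<close>.\<close>

lemma submoduleI_smult:
  assumes "H \<subseteq> carrier M" "\<zero>\<^bsub>M\<^esub> \<in> H"
    and "\<And>a b. a \<in> H \<Longrightarrow> b \<in> H \<Longrightarrow> a \<oplus>\<^bsub>M\<^esub> b \<in> H"
    and "\<And>a x. a \<in> carrier R \<Longrightarrow> x \<in> H \<Longrightarrow> a \<odot>\<^bsub>M\<^esub> x \<in> H"
  shows "submodule H R M"
proof (rule submoduleI)
  fix a assume a: "a \<in> H"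
  have "(\<ominus> \<one>) \<odot>\<^bsub>M\<^esub> a \<in> H" by (rule assms(4)) (use a in auto)
  then show "\<ominus>\<^bsub>M\<^esub> a \<in> H" using a assms(1) by (simp add: smult_l_minus subset_iff)
qed (use assms in auto)

lemma idealI_smult:
  assumes "I \<subseteq> carrier R" "\<zero> \<in> I"
    and "\<And>a b. a \<in> I \<Longrightarrow> b \<in> I \<Longrightarrow> a \<oplus> b \<in> I"
    and "\<And>a b. a \<in> carrier R \<Longrightarrow> b \<in> I \<Longrightarrow> a \<otimes> b \<in> I"
  shows "ideal I R"
proof (rule idealI[OF R.ring_axioms])
  have "\<ominus> a \<in> I" if "a \<in> I" for a
    using assms(4)[of "\<ominus> \<one>" a] that assms(1) by (auto simp: R.l_minus)
  then show "subgroup I (add_monoid R)"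
    using assms(1-3) by (intro R.add.subgroupI) (auto simp: a_inv_def)
next
  fix a x assume "a \<in> I" "x \<in> carrier R"
  then show "x \<otimes> a \<in> I" "a \<otimes> x \<in> I" using assms(1,4) R.m_comm[of a x] by auto
qed

lemma submodule_minus:
  assumes "submodule N R M" "x \<in> N" "y \<in> N"
  shows "x \<ominus>\<^bsub>M\<^esub> y \<in> N"
  using submoduleE[OF assms(1)] assms(2,3) unfolding M.minus_eq by blast

lemma submodule_zero:
  assumes "submodule N R M"
  shows "\<zero>\<^bsub>M\<^esub> \<in> N"
  using submodule_minus[OF assms] submoduleE(1,2)[OF assms] M.r_neg
  by (metis M.minus_eq all_not_in_conv subsetD)

lemma submodule_Int:
  assumes "submodule N R M" "submodule K R M"
  shows "submodule (N \<inter> K) R M"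
  using submoduleE[OF assms(1)] submoduleE[OF assms(2)]
    submodule_zero[OF assms(1)] submodule_zero[OF assms(2)]
  by (intro submoduleI_smult) auto

lemma submodule_zero_set: "submodule {\<zero>\<^bsub>M\<^esub>} R M"
  by (rule submoduleI_smult) auto

lemma submodule_vimage:
  assumes "module R N" "f \<in> mod_hom R M N" "submodule K R N"
  shows "submodule {x \<in> carrier M. f x \<in> K} R M"
proof -
  interpret N: module R N by fact
  show ?thesis
    using mod_homD[OF assms(2)] mod_hom_zero[OF assms(1,2)] N.submoduleE[OF assms(3)]
      N.submodule_zero[OF assms(3)]
    by (intro submoduleI_smult) auto
qed

lemma submodule_image:
  assumes "module R N" "f \<in> mod_hom R M N" "submodule K R M"
  shows "submodule (f ` K) R N"
proof -
  interpret N: module R N by fact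
  note K = submoduleE[OF assms(3)] submodule_zero[OF assms(3)]
  note f = mod_homD[OF assms(2)] mod_hom_zero[OF assms(1,2)]
  show ?thesis
  proof (rule N.submoduleI_smult)
    show "f ` K \<subseteq> carrier N" using K f by auto
    show "\<zero>\<^bsub>N\<^esub> \<in> f ` K" using K f by force
    show "a \<oplus>\<^bsub>N\<^esub> b \<in> f ` K" if ab: "a \<in> f ` K" "b \<in> f ` K" for a b
    proof -
      obtain u v where "u \<in> K" "v \<in> K" "a = f u" "b = f v" using ab by blast
      then show ?thesis using K(1,5) f(2)[of u v]
        by (auto simp: subset_iff intro!: image_eqI[of _ _ "u \<oplus>\<^bsub>M\<^esub> v"])
    qed
    show "r \<odot>\<^bsub>N\<^esub> a \<in> f ` K" if ra: "r \<in> carrier R" "a \<in> f ` K" for r a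
    proof -
      obtain u where "u \<in> K" "a = f u" using ra by blast
      then show ?thesis using ra K(1,4) f(3)[of r u]
        by (auto simp: subset_iff intro!: image_eqI[of _ _ "r \<odot>\<^bsub>M\<^esub> u"])
    qed
  qed
qed

lemma smult_mod_hom:
  assumes "a \<in> carrier R"
  shows "(\<lambda>x. a \<odot>\<^bsub>M\<^esub> x) \<in> mod_hom R M M"
  unfolding mod_hom_def using assms
  by (auto simp: smult_r_distr R.m_comm simp flip: smult_assoc1)

lemma minus_add_cancel:
  assumes "x \<in> carrier M" "y \<in> carrier M"
  shows "(x \<ominus>\<^bsub>M\<^esub> y) \<oplus>\<^bsub>M\<^esub> y = x"
  using assms by (simp add: M.minus_eq M.a_assoc M.l_neg)

lemma add_minus_add_cancel:
  assumes "x \<in> carrier M" "y \<in> carrier M" "z \<in> carrier M"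
  shows "(x \<oplus>\<^bsub>M\<^esub> z) \<ominus>\<^bsub>M\<^esub> (y \<oplus>\<^bsub>M\<^esub> z) = x \<ominus>\<^bsub>M\<^esub> y"
  using assms by (simp add: M.minus_eq M.minus_add M.a_ac M.r_neg1 M.r_neg)

lemma add_minus_cancel_left:
  assumes "x \<in> carrier M" "y \<in> carrier M"
  shows "(x \<oplus>\<^bsub>M\<^esub> y) \<ominus>\<^bsub>M\<^esub> x = y"
  using assms by (simp add: M.minus_eq M.a_comm[of x y] M.a_assoc M.r_neg)

section \<open>Submodules built from finitely many generators\<close>

text \<open>The sum \<open>N + R x\<close>.\<close>

definition adjoin where
  "adjoin N x = {n \<oplus>\<^bsub>M\<^esub> r \<odot>\<^bsub>M\<^esub> x | n r. n \<in> N \<and> r \<in> carrier R}"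

lemma adjoinI: "n \<in> N \<Longrightarrow> r \<in> carrier R \<Longrightarrow> n \<oplus>\<^bsub>M\<^esub> r \<odot>\<^bsub>M\<^esub> x \<in> adjoin N x"
  unfolding adjoin_def by blast

lemma submodule_adjoin:
  assumes "submodule N R M" "x \<in> carrier M"
  shows "submodule (adjoin N x) R M"
proof (rule submoduleI_smult)
  note N = submoduleE[OF assms(1)] submodule_zero[OF assms(1)]
  show "adjoin N x \<subseteq> carrier M" using N(1) assms(2) by (auto simp: adjoin_def)
  show "\<zero>\<^bsub>M\<^esub> \<in> adjoin N x" using adjoinI[of "\<zero>\<^bsub>M\<^esub>" N \<zero> x] N assms by simp
  show "a \<oplus>\<^bsub>M\<^esub> b \<in> adjoin N x" if ab: "a \<in> adjoin N x" "b \<in> adjoin N x" for a b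
  proof -
    obtain n r m s where *: "n \<in> N" "m \<in> N" "r \<in> carrier R" "s \<in> carrier R"
      "a = n \<oplus>\<^bsub>M\<^esub> r \<odot>\<^bsub>M\<^esub> x" "b = m \<oplus>\<^bsub>M\<^esub> s \<odot>\<^bsub>M\<^esub> x"
      using ab unfolding adjoin_def by blast
    then have "n \<in> carrier M" "m \<in> carrier M" using N(1) by auto
    then have "a \<oplus>\<^bsub>M\<^esub> b = (n \<oplus>\<^bsub>M\<^esub> m) \<oplus>\<^bsub>M\<^esub> (r \<oplus> s) \<odot>\<^bsub>M\<^esub> x"
      using * assms(2) by (simp add: smult_l_distr M.a_ac)
    then show ?thesis using * N(5) adjoinI by auto
  qed
  show "c \<odot>\<^bsub>M\<^esub> a \<in> adjoin N x" if ca: "c \<in> carrier R" "a \<in> adjoin N x" for c a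
  proof -
    obtain n r where *: "n \<in> N" "r \<in> carrier R" "a = n \<oplus>\<^bsub>M\<^esub> r \<odot>\<^bsub>M\<^esub> x"
      using ca unfolding adjoin_def by blast
    then have "n \<in> carrier M" using N(1) by auto
    then have "c \<odot>\<^bsub>M\<^esub> a = c \<odot>\<^bsub>M\<^esub> n \<oplus>\<^bsub>M\<^esub> (c \<otimes> r) \<odot>\<^bsub>M\<^esub> x"
      using * ca assms(2) by (simp add: smult_r_distr smult_assoc1)
    then show ?thesis using * ca N(4) adjoinI by auto
  qed
qed

lemma adjoin_superset:
  assumes "submodule N R M" "x \<in> carrier M"
  shows "N \<subseteq> adjoin N x"
proof
  fix n assume "n \<in> N"
  then show "n \<in> adjoin N x"
    using adjoinI[of n N \<zero> x] assms submoduleE(1)[OF assms(1)] by auto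
qed

lemma adjoin_self:
  assumes "submodule N R M" "x \<in> carrier M"
  shows "x \<in> adjoin N x"
  using adjoinI[of "\<zero>\<^bsub>M\<^esub>" N \<one> x] submodule_zero[OF assms(1)] assms(2) by simp

lemma adjoin_least:
  assumes "submodule K R M" "N \<subseteq> K" "x \<in> K"
  shows "adjoin N x \<subseteq> K"
  using submoduleE[OF assms(1)] assms(2,3) unfolding adjoin_def by auto

text \<open>Generators are added one at a time and then forgotten. The induction rule reduces each
  finiteness statement to the passage from \<open>N\<close> to \<open>N + R x\<close>.\<close>

inductive fg_submodule where
  fg_zero: "fg_submodule {\<zero>\<^bsub>M\<^esub>}"
| fg_adjoin: "fg_submodule N \<Longrightarrow> x \<in> carrier M \<Longrightarrow> fg_submodule (adjoin N x)"

lemma fg_submodule_imp_submodule: "fg_submodule N \<Longrightarrow> submodule N R M"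
  by (induction rule: fg_submodule.induct) (auto intro: submodule_zero_set submodule_adjoin)

text \<open>Induction on either side works because enlarging a generating set by \<open>x\<close>
  enlarges its hull \<open>H\<close> to \<open>H + R x\<close>.\<close>

lemma finitely_generated_iff_fg_submodule:
  "finitely_generated R M \<longleftrightarrow> fg_submodule (carrier M)"
proof
  let ?h = "\<lambda>S. (\<lambda>N. submodule N R M) hull S"
  have "fg_submodule (?h S)" if "finite S" "S \<subseteq> carrier M" for S
    using that
  proof (induction S rule: finite_induct)
    case empty
    have "?h {} = {\<zero>\<^bsub>M\<^esub>}"
      by (rule hull_unique) (auto intro: submodule_zero_set submodule_zero)
    then show ?case by (simp add: fg_zero)
  next
    case (insert x S)
    then have fg: "fg_submodule (?h S)" and x: "x \<in> carrier M" by auto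
    note sm = fg_submodule_imp_submodule[OF fg]
    have "?h (insert x S) = adjoin (?h S) x"
    proof (rule hull_unique)
      show "insert x S \<subseteq> adjoin (?h S) x"
        using adjoin_self[OF sm x] adjoin_superset[OF sm x] hull_subset[of S "\<lambda>N. submodule N R M"]
        by auto
      show "submodule (adjoin (?h S) x) R M" by (rule submodule_adjoin[OF sm x])
      fix t assume "insert x S \<subseteq> t" "submodule t R M"
      then show "adjoin (?h S) x \<subseteq> t" by (intro adjoin_least hull_minimal) auto
    qed
    then show ?case using fg_adjoin[OF fg x] by simp
  qed
  then show "finitely_generated R M \<Longrightarrow> fg_submodule (carrier M)"
    unfolding finitely_generated_def by metis
  have "\<exists>S. finite S \<and> S \<subseteq> carrier M \<and> ?h S = N" if "fg_submodule N" for N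
    using that
  proof (induction rule: fg_submodule.induct)
    case fg_zero
    have "?h {} = {\<zero>\<^bsub>M\<^esub>}"
      by (rule hull_unique) (auto intro: submodule_zero_set submodule_zero)
    then show ?case by blast
  next
    case (fg_adjoin N x)
    then obtain S where S: "finite S" "S \<subseteq> carrier M" "?h S = N" by blast
    note sm = fg_submodule_imp_submodule[OF fg_adjoin.hyps(1)]
    have "?h (insert x S) = adjoin N x"
    proof (rule hull_unique)
      show "insert x S \<subseteq> adjoin N x"
        using adjoin_self[OF sm fg_adjoin.hyps(2)] adjoin_superset[OF sm fg_adjoin.hyps(2)]
          hull_subset[of S "\<lambda>N. submodule N R M"] S(3)
        by auto
      show "submodule (adjoin N x) R M" by (rule submodule_adjoin[OF sm fg_adjoin.hyps(2)])
      fix t assume "insert x S \<subseteq> t" "submodule t R M"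
      then show "adjoin N x \<subseteq> t"
        using S(3) hull_minimal[of S t "\<lambda>N. submodule N R M"] by (intro adjoin_least) auto
    qed
    then show ?case using S fg_adjoin.hyps(2) by (intro exI[of _ "insert x S"]) auto
  qed
  then show "fg_submodule (carrier M) \<Longrightarrow> finitely_generated R M"
    unfolding finitely_generated_def by blast
qed

lemma fg_submodule_image:
  assumes "module R N" "f \<in> mod_hom R M N" "fg_submodule K"
  shows "module.fg_submodule R N (f ` K)"
  using assms(3)
proof (induction rule: fg_submodule.induct)
  interpret N: module R N by fact
  case fg_zero
  then show ?case using mod_hom_zero[OF assms(1,2)] N.fg_zero by simp
next
  interpret N: module R N by fact
  case (fg_adjoin K x)
  have "f (n \<oplus>\<^bsub>M\<^esub> r \<odot>\<^bsub>M\<^esub> x) = f n \<oplus>\<^bsub>N\<^esub> r \<odot>\<^bsub>N\<^esub> f x" if "n \<in> K" "r \<in> carrier R" for n r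
    using that mod_homD[OF assms(2)] submoduleE(1)[OF fg_submodule_imp_submodule[OF fg_adjoin.hyps(1)]]
      fg_adjoin.hyps(2) by (simp add: subset_iff)
  then have "f ` adjoin K x = N.adjoin (f ` K) (f x)"
    unfolding adjoin_def N.adjoin_def by (auto simp: image_iff) metis+
  then show ?case using N.fg_adjoin[OF fg_adjoin.IH] mod_homD(1)[OF assms(2) fg_adjoin.hyps(2)] by simp
qed

text \<open>Generators of the kernel together with lifts of generators of the image generate
  \<open>N\<close>. The induction lifts one generator of the image at a time.\<close>

lemma fg_submodule_extension:
  assumes "module R M'" "f \<in> mod_hom R M M'" "module.fg_submodule R M' Q"
    and "submodule N R M" "f ` N = Q" "fg_submodule {x \<in> N. f x = \<zero>\<^bsub>M'\<^esub>}"
  shows "fg_submodule N"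
proof -
  interpret M': module R M' by fact
  note f = mod_homD[OF assms(2)]
  from assms(3-6) show ?thesis
  proof (induction arbitrary: N rule: M'.fg_submodule.induct)
    case fg_zero
    then have "{x \<in> N. f x = \<zero>\<^bsub>M'\<^esub>} = N" by auto
    then show ?case using fg_zero by simp
  next
    case (fg_adjoin Q y)
    note Q = M'.fg_submodule_imp_submodule[OF fg_adjoin.hyps(1)]
    note N = submoduleE[OF fg_adjoin.prems(1)]
    \<comment> \<open>The part of \<open>N\<close> above the smaller \<open>Q\<close>. It contains
      the whole kernel, so the induction hypothesis applies to it; a lift \<open>x\<close> of
      \<open>y\<close> then generates the rest of \<open>N\<close>.\<close>
    define N' where "N' = N \<inter> {x \<in> carrier M. f x \<in> Q}"
    have N': "submodule N' R M"
      unfolding N'_def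
      by (rule submodule_Int[OF fg_adjoin.prems(1) submodule_vimage[OF assms(1,2) Q]])
    have "Q \<subseteq> f ` N"
      using M'.adjoin_superset[OF Q fg_adjoin.hyps(2)] fg_adjoin.prems(2) by simp
    then have img: "f ` N' = Q" using N(1) unfolding N'_def by blast
    have "{x \<in> N'. f x = \<zero>\<^bsub>M'\<^esub>} = {x \<in> N. f x = \<zero>\<^bsub>M'\<^esub>}"
      using M'.submodule_zero[OF Q] N(1) unfolding N'_def by auto
    then have fg: "fg_submodule N'" using fg_adjoin.IH[OF N' img] fg_adjoin.prems(3) by simp
    obtain x where x: "x \<in> N" "f x = y"
      using M'.adjoin_self[OF Q fg_adjoin.hyps(2)] fg_adjoin.prems(2) by (metis imageE)
    have xM: "x \<in> carrier M" using x N by auto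
    have "N = adjoin N' x"
    proof
      show "adjoin N' x \<subseteq> N"
        by (rule adjoin_least[OF fg_adjoin.prems(1)]) (use x in \<open>auto simp: N'_def\<close>)
      show "N \<subseteq> adjoin N' x"
      proof
        fix z assume z: "z \<in> N"
        then have zM: "z \<in> carrier M" using N by auto
        have "f z \<in> M'.adjoin Q y" using z fg_adjoin.prems(2) by auto
        then obtain q r where q: "q \<in> Q" "r \<in> carrier R" "f z = q \<oplus>\<^bsub>M'\<^esub> r \<odot>\<^bsub>M'\<^esub> y"
          unfolding M'.adjoin_def by auto
        have qM: "q \<in> carrier M'" using M'.submoduleE(1)[OF Q] q by auto
        have "f (z \<ominus>\<^bsub>M\<^esub> r \<odot>\<^bsub>M\<^esub> x) = f z \<ominus>\<^bsub>M'\<^esub> r \<odot>\<^bsub>M'\<^esub> y"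
          using mod_hom_minus[OF assms(1,2) zM, of "r \<odot>\<^bsub>M\<^esub> x"] f xM x q by simp
        also have "\<dots> = q"
          using q qM fg_adjoin.hyps(2) by (simp add: M'.M.minus_eq M'.M.a_assoc M'.M.r_neg)
        finally have "z \<ominus>\<^bsub>M\<^esub> r \<odot>\<^bsub>M\<^esub> x \<in> N'"
          using q z x xM zM N(4) submodule_minus[OF fg_adjoin.prems(1) z] unfolding N'_def by auto
        from adjoinI[OF this q(2), of x] show "z \<in> adjoin N' x"
          using minus_add_cancel[OF zM, of "r \<odot>\<^bsub>M\<^esub> x"] xM q by simp
      qed
    qed
    then show ?case using fg_submodule.fg_adjoin[OF fg xM] by simp
  qed
qed

text \<open>Each of the finitely many generators appears at some stage, and the largest of these
  stages contains them all.\<close>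

lemma fg_submodule_chain:
  assumes "fg_submodule N" "\<And>n::nat. submodule (K n) R M" "\<And>n. K n \<subseteq> K (Suc n)"
    and "N \<subseteq> (\<Union>n. K n)"
  shows "\<exists>n. N \<subseteq> K n"
  using assms(1,4)
proof (induction rule: fg_submodule.induct)
  case fg_zero
  then show ?case by auto
next
  case (fg_adjoin N x)
  note N = fg_submodule_imp_submodule[OF fg_adjoin.hyps(1)]
  obtain n where n: "N \<subseteq> K n"
    using fg_adjoin.IH fg_adjoin.prems adjoin_superset[OF N fg_adjoin.hyps(2)] by blast
  obtain m where m: "x \<in> K m"
    using adjoin_self[OF N fg_adjoin.hyps(2)] fg_adjoin.prems by auto
  have "K n \<subseteq> K (max n m)" "K m \<subseteq> K (max n m)"
    using lift_Suc_mono_le[of K, OF assms(3)] by auto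
  then have "adjoin N x \<subseteq> K (max n m)"
    using n m by (intro adjoin_least[OF assms(2)]) auto
  then show ?case by blast
qed

text \<open>These are the \<open>r\<close> for which \<open>r x\<close> lies in \<open>K\<close>
  modulo \<open>N\<close>. Together with \<open>N \<inter> K\<close> this ideal controls a submodule
  \<open>K\<close> of \<open>N + R x\<close>, so properties of ideals of \<open>R\<close> pass to
  submodules.\<close>

lemma coeff_ideal:
  assumes "submodule N R M" "submodule K R M" "x \<in> carrier M"
  shows "ideal {r \<in> carrier R. \<exists>n\<in>N. n \<oplus>\<^bsub>M\<^esub> r \<odot>\<^bsub>M\<^esub> x \<in> K} R"
proof (rule idealI_smult)
  note N = submoduleE[OF assms(1)] submodule_zero[OF assms(1)]
  note K = submoduleE[OF assms(2)] submodule_zero[OF assms(2)]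
  let ?I = "{r \<in> carrier R. \<exists>n\<in>N. n \<oplus>\<^bsub>M\<^esub> r \<odot>\<^bsub>M\<^esub> x \<in> K}"
  show "?I \<subseteq> carrier R" by auto
  show "\<zero> \<in> ?I" using N K assms(3) by (auto intro!: bexI[of _ "\<zero>\<^bsub>M\<^esub>"])
  show "a \<oplus> b \<in> ?I" if ab: "a \<in> ?I" "b \<in> ?I" for a b
  proof -
    obtain n m where *: "n \<in> N" "m \<in> N" "n \<oplus>\<^bsub>M\<^esub> a \<odot>\<^bsub>M\<^esub> x \<in> K" "m \<oplus>\<^bsub>M\<^esub> b \<odot>\<^bsub>M\<^esub> x \<in> K"
      using ab by auto
    then have "n \<in> carrier M" "m \<in> carrier M" using N(1) by auto
    then have "(n \<oplus>\<^bsub>M\<^esub> m) \<oplus>\<^bsub>M\<^esub> (a \<oplus> b) \<odot>\<^bsub>M\<^esub> x = (n \<oplus>\<^bsub>M\<^esub> a \<odot>\<^bsub>M\<^esub> x) \<oplus>\<^bsub>M\<^esub> (m \<oplus>\<^bsub>M\<^esub> b \<odot>\<^bsub>M\<^esub> x)"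
      using ab assms(3) by (simp add: smult_l_distr M.a_ac)
    then show ?thesis using ab * N(5) K(5) by auto metis
  qed
  show "a \<otimes> b \<in> ?I" if ab: "a \<in> carrier R" "b \<in> ?I" for a b
  proof -
    obtain n where *: "n \<in> N" "n \<oplus>\<^bsub>M\<^esub> b \<odot>\<^bsub>M\<^esub> x \<in> K"
      using ab by auto
    then have "n \<in> carrier M" using N(1) by auto
    then have "a \<odot>\<^bsub>M\<^esub> n \<oplus>\<^bsub>M\<^esub> (a \<otimes> b) \<odot>\<^bsub>M\<^esub> x = a \<odot>\<^bsub>M\<^esub> (n \<oplus>\<^bsub>M\<^esub> b \<odot>\<^bsub>M\<^esub> x)"
      using ab assms(3) by (simp add: smult_r_distr smult_assoc1)
    then show ?thesis using ab * N(4) K(4) by auto metis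
  qed
qed

section \<open>Surjective endomorphisms\<close>

text \<open>The kernels \<open>K n\<close> of \<open>f ^^ n\<close> increase, and they stabilise
  because their union is finitely generated. If \<open>f x = 0\<close>, surjectivity gives
  \<open>x = (f ^^ n) y\<close>; then \<open>y\<close> lies in \<open>K (Suc n)\<close>, hence in
  \<open>K n\<close>, and \<open>x = 0\<close>.\<close>

lemma fg_submodules_imp_hopfian:
  assumes fg: "\<And>K. submodule K R M \<Longrightarrow> fg_submodule K"
  shows "hopfian R M"
  unfolding hopfian_def
proof (intro ballI impI)
  fix f assume f: "f \<in> mod_hom R M M" and surj: "f ` carrier M = carrier M"
  define K where "K n = {x \<in> carrier M. (f ^^ n) x \<in> {\<zero>\<^bsub>M\<^esub>}}" for n
  have sm: "submodule (K n) R M" for n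
    unfolding K_def by (rule submodule_vimage[OF module_axioms mod_hom_funpow[OF f] submodule_zero_set])
  have mono: "K n \<subseteq> K (Suc n)" for n
    using mod_hom_zero[OF module_axioms f] by (auto simp: K_def)
  have le: "K n \<subseteq> K m" if "n \<le> m" for n m
    using lift_Suc_mono_le[of K, OF mono] that by auto
  have "submodule (\<Union>n. K n) R M"
  proof (rule submoduleI_smult)
    show "(\<Union>n. K n) \<subseteq> carrier M" by (auto simp: K_def)
    show "\<zero>\<^bsub>M\<^esub> \<in> (\<Union>n. K n)" using submodule_zero[OF sm] by blast
    show "a \<odot>\<^bsub>M\<^esub> x \<in> (\<Union>n. K n)" if "a \<in> carrier R" "x \<in> (\<Union>n. K n)" for a x
      using submoduleE(4)[OF sm that(1)] that(2) by blast
    show "a \<oplus>\<^bsub>M\<^esub> b \<in> (\<Union>n. K n)" if ab: "a \<in> (\<Union>n. K n)" "b \<in> (\<Union>n. K n)" for a b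
    proof -
      obtain n m where "a \<in> K n" "b \<in> K m" using ab by auto
      then have "a \<in> K (max n m)" "b \<in> K (max n m)" using le[of n "max n m"] le[of m "max n m"] by auto
      then show ?thesis using submoduleE(5)[OF sm] by blast
    qed
  qed
  then obtain n where n: "(\<Union>n. K n) \<subseteq> K n"
    using fg_submodule_chain[of "\<Union>n. K n" K] fg sm mono by blast
  have surjn: "(f ^^ k) ` carrier M = carrier M" for k
    by (induction k) (simp, simp only: funpow.simps image_comp[symmetric] surj)
  have ker: "x = \<zero>\<^bsub>M\<^esub>" if x: "x \<in> carrier M" "f x = \<zero>\<^bsub>M\<^esub>" for x
  proof -
    obtain y where y: "y \<in> carrier M" "x = (f ^^ n) y" using surjn[of n] x by (metis imageE)
    then have "y \<in> K (Suc n)" using x by (simp add: K_def)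
    then have "y \<in> K n" using n by blast
    then show ?thesis using y by (simp add: K_def)
  qed
  have "inj_on f (carrier M)"
  proof (rule inj_onI)
    fix x y assume xy: "x \<in> carrier M" "y \<in> carrier M" "f x = f y"
    then have "f (x \<ominus>\<^bsub>M\<^esub> y) = \<zero>\<^bsub>M\<^esub>"
      using mod_hom_minus[OF module_axioms f xy(1,2)] mod_homD(1)[OF f xy(1)]
      by (metis M.minus_eq M.r_neg)
    then show "x = y" using ker[of "x \<ominus>\<^bsub>M\<^esub> y"] xy minus_add_cancel[of x y] by simp
  qed
  then show "f \<in> mod_iso R M M" using f surj by (simp add: mod_iso_def bij_betw_def)
qed

end

subsection \<open>Modules over Artinian principal ideal rings\<close>

context principal_ideal_cring
begin

lemma ideal_generator:
  assumes "ideal I R"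
  obtains d where "d \<in> I" "\<And>r. r \<in> I \<Longrightarrow> \<exists>s\<in>carrier R. r = s \<otimes> d"
proof -
  obtain d where d: "d \<in> carrier R" "I = Idl {d}"
    using principalideal.generate[OF every_ideal_principal[OF assms]] by blast
  then have "I = PIdl d" by (simp add: cgenideal_eq_genideal)
  then show ?thesis using that[of d] cgenideal_self[OF d(1)] unfolding cgenideal_def by blast
qed

end

locale artinian_pir = artinian_cring + principal_ideal_cring

locale artinian_pir_module = module R M + artinian_pir R
  for R (structure) and M (structure)
begin

section \<open>Both chain conditions for finitely generated modules\<close>

text \<open>For \<open>K\<close> inside \<open>N + R x\<close> the coefficient ideal is generated by
  some \<open>d\<close>. An element \<open>k0 = n0 + d x\<close> of \<open>K\<close> then gives
  \<open>K = (N \<inter> K) + R k0\<close>, and the induction hypothesis covers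
  \<open>N \<inter> K\<close>.\<close>

lemma fg_submodule_subset:
  assumes "fg_submodule N" "submodule K R M" "K \<subseteq> N"
  shows "fg_submodule K"
  using assms
proof (induction arbitrary: K rule: fg_submodule.induct)
  case fg_zero
  then have "K = {\<zero>\<^bsub>M\<^esub>}" using submodule_zero by blast
  then show ?case using fg_submodule.fg_zero by simp
next
  case (fg_adjoin N x)
  note N = fg_submodule_imp_submodule[OF fg_adjoin.hyps(1)]
  note K = fg_adjoin.prems(1)
  note x = fg_adjoin.hyps(2)
  obtain d where d: "d \<in> {r \<in> carrier R. \<exists>n\<in>N. n \<oplus>\<^bsub>M\<^esub> r \<odot>\<^bsub>M\<^esub> x \<in> K}"
    "\<And>r. r \<in> {r \<in> carrier R. \<exists>n\<in>N. n \<oplus>\<^bsub>M\<^esub> r \<odot>\<^bsub>M\<^esub> x \<in> K} \<Longrightarrow> \<exists>s\<in>carrier R. r = s \<otimes> d"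
    using ideal_generator[OF coeff_ideal[OF N K x]] by blast
  then obtain n0 where n0: "n0 \<in> N" "n0 \<oplus>\<^bsub>M\<^esub> d \<odot>\<^bsub>M\<^esub> x \<in> K" and dR: "d \<in> carrier R" by auto
  define k0 where "k0 = n0 \<oplus>\<^bsub>M\<^esub> d \<odot>\<^bsub>M\<^esub> x"
  have n0M: "n0 \<in> carrier M" using n0 submoduleE(1)[OF N] by auto
  have k0: "k0 \<in> carrier M" "k0 \<in> K" using n0 n0M dR x by (auto simp: k0_def)
  have "K = adjoin (N \<inter> K) k0"
  proof
    show "adjoin (N \<inter> K) k0 \<subseteq> K" by (rule adjoin_least[OF K]) (use k0 in auto)
    show "K \<subseteq> adjoin (N \<inter> K) k0"
    proof
      fix y assume y: "y \<in> K"
      then have yM: "y \<in> carrier M" using submoduleE(1)[OF K] by auto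
      obtain n r where nr: "n \<in> N" "r \<in> carrier R" "y = n \<oplus>\<^bsub>M\<^esub> r \<odot>\<^bsub>M\<^esub> x"
        using y fg_adjoin.prems(2) unfolding adjoin_def by blast
      then obtain s where s: "s \<in> carrier R" "r = s \<otimes> d" using d(2)[of r] y by auto
      have nM: "n \<in> carrier M" using nr submoduleE(1)[OF N] by auto
      \<comment> \<open>As \<open>r = s d\<close>, subtracting \<open>s k0\<close> removes the
        multiple of \<open>x\<close> and leaves an element of \<open>N\<close>.\<close>
      have "y \<ominus>\<^bsub>M\<^esub> s \<odot>\<^bsub>M\<^esub> k0 = (n \<oplus>\<^bsub>M\<^esub> r \<odot>\<^bsub>M\<^esub> x) \<ominus>\<^bsub>M\<^esub> (s \<odot>\<^bsub>M\<^esub> n0 \<oplus>\<^bsub>M\<^esub> r \<odot>\<^bsub>M\<^esub> x)"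
        using nr s dR x n0M by (simp add: k0_def smult_r_distr smult_assoc1)
      also have "\<dots> = n \<ominus>\<^bsub>M\<^esub> s \<odot>\<^bsub>M\<^esub> n0"
        using nr s n0M nM x by (intro add_minus_add_cancel) auto
      finally have "y \<ominus>\<^bsub>M\<^esub> s \<odot>\<^bsub>M\<^esub> k0 \<in> N \<inter> K"
        using submodule_minus[OF N nr(1) submoduleE(4)[OF N s(1) n0(1)]]
          submodule_minus[OF K y submoduleE(4)[OF K s(1) k0(2)]] by simp
      from adjoinI[OF this s(1), of k0] show "y \<in> adjoin (N \<inter> K) k0"
        using minus_add_cancel[OF yM, of "s \<odot>\<^bsub>M\<^esub> k0"] s k0 by simp
    qed
  qed
  moreover have "fg_submodule (N \<inter> K)" by (rule fg_adjoin.IH[OF submodule_Int[OF N K]]) auto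
  ultimately show ?case using fg_submodule.fg_adjoin[OF _ k0(1), of "N \<inter> K"] by simp
qed

text \<open>Nested submodules of \<open>N + R x\<close> coincide once their coefficient ideals and
  their intersections with \<open>N\<close> do. The ideals stabilise because \<open>R\<close> is
  Artinian, the intersections by induction.\<close>

lemma fg_submodule_dcc:
  assumes "fg_submodule N" "\<And>n::nat. submodule (K n) R M" "\<And>n. K (Suc n) \<subseteq> K n" "K 0 \<subseteq> N"
  shows "\<exists>n. \<forall>m\<ge>n. K m = K n"
  using assms
proof (induction arbitrary: K rule: fg_submodule.induct)
  case fg_zero
  have "K n = {\<zero>\<^bsub>M\<^esub>}" for n
    using lift_Suc_antimono_le[of K, OF fg_zero(2), of 0 n] fg_zero(3) submodule_zero[OF fg_zero(1)] by auto
  then show ?case by simp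
next
  case (fg_adjoin N x)
  note N = fg_submodule_imp_submodule[OF fg_adjoin.hyps(1)]
  note K = fg_adjoin.prems(1)
  note x = fg_adjoin.hyps(2)
  have anti: "K m \<subseteq> K n" if "n \<le> m" for n m
    using lift_Suc_antimono_le[of K, OF fg_adjoin.prems(2)] that by auto
  define I where "I k = {r \<in> carrier R. \<exists>n\<in>N. n \<oplus>\<^bsub>M\<^esub> r \<odot>\<^bsub>M\<^esub> x \<in> K k}" for k
  have "\<exists>n. \<forall>m\<ge>n. I m = I n"
    using coeff_ideal[OF N K x] fg_adjoin.prems(2)
    by (intro descending_chain_stabilises) (auto simp: I_def)
  then obtain a where a: "\<And>m. m \<ge> a \<Longrightarrow> I m = I a" by auto
  have "\<exists>n. \<forall>m\<ge>n. N \<inter> K m = N \<inter> K n"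
    using fg_adjoin.prems(2) by (intro fg_adjoin.IH submodule_Int[OF N K]) auto
  then obtain b where b: "\<And>m. m \<ge> b \<Longrightarrow> N \<inter> K m = N \<inter> K b" by auto
  define c where "c = max a b"
  have "K c \<subseteq> K m" if m: "m \<ge> c" for m
  proof
    fix y assume y: "y \<in> K c"
    then have "y \<in> adjoin N x" using anti[of 0 c] fg_adjoin.prems(3) by auto
    then obtain n r where nr: "n \<in> N" "r \<in> carrier R" "y = n \<oplus>\<^bsub>M\<^esub> r \<odot>\<^bsub>M\<^esub> x"
      unfolding adjoin_def by blast
    then have "r \<in> I c" using y by (auto simp: I_def)
    then have "r \<in> I m" using a[of m] a[of c] m by (simp add: c_def)
    then obtain n' where n': "n' \<in> N" "n' \<oplus>\<^bsub>M\<^esub> r \<odot>\<^bsub>M\<^esub> x \<in> K m" by (auto simp: I_def)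
    have nM: "n \<in> carrier M" "n' \<in> carrier M" using nr n' submoduleE(1)[OF N] by auto
    have "y \<ominus>\<^bsub>M\<^esub> (n' \<oplus>\<^bsub>M\<^esub> r \<odot>\<^bsub>M\<^esub> x) = n \<ominus>\<^bsub>M\<^esub> n'"
      unfolding nr(3) using nM nr x by (intro add_minus_add_cancel) auto
    moreover have "n' \<oplus>\<^bsub>M\<^esub> r \<odot>\<^bsub>M\<^esub> x \<in> K c" using anti[OF m] n' by auto
    ultimately have "y \<ominus>\<^bsub>M\<^esub> (n' \<oplus>\<^bsub>M\<^esub> r \<odot>\<^bsub>M\<^esub> x) \<in> N \<inter> K c"
      using submodule_minus[OF K y, of "n' \<oplus>\<^bsub>M\<^esub> r \<odot>\<^bsub>M\<^esub> x"] submodule_minus[OF N nr(1) n'(1)] by auto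
    then have "y \<ominus>\<^bsub>M\<^esub> (n' \<oplus>\<^bsub>M\<^esub> r \<odot>\<^bsub>M\<^esub> x) \<in> K m"
      using b[of m] b[of c] m by (auto simp: c_def)
    then have "(y \<ominus>\<^bsub>M\<^esub> (n' \<oplus>\<^bsub>M\<^esub> r \<odot>\<^bsub>M\<^esub> x)) \<oplus>\<^bsub>M\<^esub> (n' \<oplus>\<^bsub>M\<^esub> r \<odot>\<^bsub>M\<^esub> x) \<in> K m"
      using n' submoduleE(5)[OF K] by blast
    moreover have "y \<in> carrier M" using y submoduleE(1)[OF K] by auto
    ultimately show "y \<in> K m" using minus_add_cancel[of y "n' \<oplus>\<^bsub>M\<^esub> r \<odot>\<^bsub>M\<^esub> x"] nM nr x by simp
  qed
  then show ?case using anti by blast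
qed

lemma fg_imp_bi_hopfian:
  assumes fg: "fg_submodule (carrier M)"
  shows "bi_hopfian R M"
  unfolding bi_hopfian_def
proof
  show "hopfian R M"
    by (rule fg_submodules_imp_hopfian) (use fg_submodule_subset[OF fg] submoduleE(1) in blast)
  show "co_hopfian R M"
    unfolding co_hopfian_def
  proof (intro ballI impI)
    fix f assume f: "f \<in> mod_hom R M M" and inj: "inj_on f (carrier M)"
    define K where "K n = (f ^^ n) ` carrier M" for n
    have anti: "K (Suc n) \<subseteq> K n" for n
      unfolding K_def funpow_Suc_right image_comp[symmetric] using mod_homD(1)[OF f] by blast
    have "\<exists>n. \<forall>m\<ge>n. K m = K n"
    proof (rule fg_submodule_dcc[OF fg])
      show "submodule (K n) R M" for n
        unfolding K_def
        by (rule submodule_image[OF module_axioms mod_hom_funpow[OF f] carrier_is_submodule])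
      show "K (Suc n) \<subseteq> K n" for n by (rule anti)
      show "K 0 \<subseteq> carrier M" by (simp add: K_def)
    qed
    then obtain n where Kn: "K (Suc n) = K n" by (meson le_Suc_eq order_refl)
    have "inj_on (f ^^ n) (carrier M)"
    proof (induction n)
      case (Suc n)
      have "(f ^^ n) ` carrier M \<subseteq> carrier M" using mod_homD(1)[OF mod_hom_funpow[OF f]] by blast
      then show ?case unfolding funpow.simps by (rule comp_inj_on[OF Suc inj_on_subset[OF inj]])
    qed simp
    \<comment> \<open>With the innermost \<open>f\<close> split off, \<open>K (Suc n) = K n\<close>
      equates two images under the injective map \<open>f ^^ n\<close>, which can be cancelled to
      give surjectivity of \<open>f\<close>.\<close>
    moreover have "(f ^^ n) ` f ` carrier M = (f ^^ n) ` carrier M"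
      using Kn unfolding K_def funpow_Suc_right image_comp .
    moreover have "f ` carrier M \<subseteq> carrier M" using mod_homD(1)[OF f] by blast
    ultimately have "f ` carrier M = carrier M"
      by (metis inj_on_image_eq_iff order_refl)
    then show "f \<in> mod_iso R M M" using f inj by (simp add: mod_iso_def bij_betw_def)
  qed
qed

end

section \<open>Maximal ideals with a single generator\<close>

lemma (in cring) mem_cgenideal_iff: "x \<in> PIdl p \<longleftrightarrow> (\<exists>s\<in>carrier R. x = s \<otimes> p)"
  unfolding cgenideal_def by auto

lemma (in cring) one_notin_maximal:
  assumes "maximalideal I R"
  shows "\<one> \<notin> I"
  using maximalideal.I_notcarr[OF assms] ideal.one_imp_carrier[OF maximalideal.axioms(1)[OF assms]]
  by auto

text \<open>The ideal \<open>(r) + (p)\<close> properly contains the maximal ideal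
  \<open>(p)\<close>, so it contains \<open>\<one>\<close>. This plays the part of division in the
  field \<open>R/(p)\<close>.\<close>

lemma (in cring) maximal_cgenideal_bezout:
  assumes p: "p \<in> carrier R" "maximalideal (PIdl p) R" and r: "r \<in> carrier R" "r \<notin> PIdl p"
  shows "\<exists>a\<in>carrier R. \<exists>b\<in>carrier R. a \<otimes> r \<oplus> b \<otimes> p = \<one>"
proof -
  let ?J = "set_add R (PIdl r) (PIdl p)"
  have J: "ideal ?J R" by (rule add_ideals[OF cgenideal_ideal[OF r(1)] cgenideal_ideal[OF p(1)]])
  have mem: "a \<otimes> r \<oplus> b \<otimes> p \<in> ?J" if "a \<in> carrier R" "b \<in> carrier R" for a b
  proof -
    have "a \<otimes> r \<in> PIdl r" "b \<otimes> p \<in> PIdl p" using that by (auto simp: mem_cgenideal_iff)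
    then show ?thesis unfolding set_add_def' by blast
  qed
  have "PIdl p \<subseteq> ?J"
  proof
    fix x assume "x \<in> PIdl p"
    then obtain s where "s \<in> carrier R" "x = s \<otimes> p" by (auto simp: mem_cgenideal_iff)
    then show "x \<in> ?J" using mem[of \<zero> s] p r by simp
  qed
  moreover have "?J \<subseteq> carrier R" using ideal.Icarr[OF J] by blast
  moreover have "r \<in> ?J" using mem[of \<one> \<zero>] p r by simp
  ultimately have "?J = carrier R" using maximalideal.I_maximal[OF p(2) J] r(2) by blast
  then have "\<one> \<in> ?J" by simp
  then obtain x y where "x \<in> PIdl r" "y \<in> PIdl p" "\<one> = x \<oplus> y" unfolding set_add_def' by blast
  then show ?thesis by (auto simp: mem_cgenideal_iff)
qed

context principal_ideal_cring
begin

lemma noetherian: "noetherian_ring R"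
proof (rule noetherian_ringI)
  fix I assume "ideal I R"
  then show "\<exists>A\<subseteq>carrier R. finite A \<and> I = Idl A"
    using principalideal.generate[OF every_ideal_principal]
    by (metis empty_subsetI finite.emptyI finite.insertI insert_subset)
qed

text \<open>Zorn's lemma for the proper ideals above \<open>I\<close>: in a Noetherian ring a
  nonempty chain of ideals contains its own union. Like every ideal here, the maximal one has a
  single generator.\<close>

lemma exists_maximal_cgenideal:
  assumes I: "ideal I R" "\<one> \<notin> I"
  obtains p where "p \<in> carrier R" "maximalideal (PIdl p) R" "I \<subseteq> PIdl p"
proof -
  interpret N: noetherian_ring R by (rule noetherian)
  let ?A = "{J. ideal J R \<and> I \<subseteq> J \<and> \<one> \<notin> J}"
  have "\<exists>J\<in>?A. \<forall>H\<in>?A. J \<subseteq> H \<longrightarrow> H = J"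
  proof (rule subset_Zorn_nonempty)
    show "?A \<noteq> {}" using I by auto
    fix C assume C: "C \<noteq> {}" "subset.chain ?A C"
    then have "subset.chain {J. ideal J R} C" unfolding subset_chain_def by auto
    then have "\<Union>C \<in> C" by (rule N.ideal_chain_is_trivial[OF C(1)])
    then show "\<Union>C \<in> ?A" using C(2) unfolding subset_chain_def by blast
  qed
  then obtain J where J: "ideal J R" "I \<subseteq> J" "\<one> \<notin> J"
    and max: "\<And>H. ideal H R \<Longrightarrow> J \<subseteq> H \<Longrightarrow> \<one> \<notin> H \<Longrightarrow> H = J" by auto
  obtain p where p: "p \<in> J" "\<And>r. r \<in> J \<Longrightarrow> \<exists>s\<in>carrier R. r = s \<otimes> p"
    using ideal_generator[OF J(1)] by blast
  have pR: "p \<in> carrier R" by (rule ideal.Icarr[OF J(1) p(1)])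
  have "J = PIdl p" using p cgenideal_minimal[OF J(1) p(1)] by (auto simp: mem_cgenideal_iff)
  moreover have "maximalideal J R"
  proof (rule maximalidealI[OF J(1)])
    show "carrier R \<noteq> J" using J(3) by auto
    fix H assume "ideal H R" "J \<subseteq> H" "H \<subseteq> carrier R"
    then show "H = J \<or> H = carrier R" using max[of H] ideal.one_imp_carrier by blast
  qed
  ultimately show ?thesis using that pR J(2) by simp
qed

end

context artinian_pir
begin

text \<open>If \<open>d \<noteq> 0\<close> and \<open>(p)\<close> is a maximal ideal containing the annihilator of \<open>d\<close>, then \<open>(p d)\<close> is
  strictly smaller than \<open>(d)\<close>. Hence products of such \<open>p\<close> reach \<open>0\<close>.\<close>

lemma zero_induct_maximal:
  assumes one: "P \<one>"
    and mult: "\<And>p d. p \<in> carrier R \<Longrightarrow> maximalideal (PIdl p) R \<Longrightarrow> d \<in> carrier R \<Longrightarrow> P d \<Longrightarrow> P (p \<otimes> d)"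
  shows "P \<zero>"
proof (rule ccontr)
  assume not: "\<not> P \<zero>"
  have "\<exists>p. p \<in> carrier R \<and> maximalideal (PIdl p) R \<and> (\<forall>s\<in>carrier R. s \<otimes> d = \<zero> \<longrightarrow> s \<in> PIdl p)"
    if d: "d \<in> carrier R" "P d" for d
  proof -
    let ?I = "{s \<in> carrier R. s \<otimes> d = \<zero>}"
    have "ideal ?I R"
    proof (rule idealI[OF ring_axioms])
      show "subgroup ?I (add_monoid R)"
        using d by (intro add.subgroupI) (auto simp: l_distr l_minus simp flip: a_inv_def intro!: exI[of _ \<zero>])
      show "x \<otimes> a \<in> ?I" "a \<otimes> x \<in> ?I" if "a \<in> ?I" "x \<in> carrier R" for a x
        using that d m_comm[of a x] by (auto simp: m_assoc)
    qed
    \<comment> \<open>\<open>P d\<close> and the failure of \<open>P \<zero>\<close> force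
      \<open>d\<close> to be nonzero, so its annihilator is proper.\<close>
    moreover have "\<one> \<notin> ?I" using d not by auto
    ultimately obtain p where "p \<in> carrier R" "maximalideal (PIdl p) R" "?I \<subseteq> PIdl p"
      by (rule exists_maximal_cgenideal)
    then show ?thesis by (intro exI[of _ p]) auto
  qed
  then obtain \<pi> where \<pi>: "\<And>d. d \<in> carrier R \<Longrightarrow> P d \<Longrightarrow> \<pi> d \<in> carrier R"
    "\<And>d. d \<in> carrier R \<Longrightarrow> P d \<Longrightarrow> maximalideal (PIdl (\<pi> d)) R"
    "\<And>d s. d \<in> carrier R \<Longrightarrow> P d \<Longrightarrow> s \<in> carrier R \<Longrightarrow> s \<otimes> d = \<zero> \<Longrightarrow> s \<in> PIdl (\<pi> d)"
    by metis
  \<comment> \<open>Each \<open>D n\<close> is multiplied by a generator of a maximal ideal above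
    its annihilator. The ideals \<open>(D n)\<close> descend and so must stabilise.\<close>
  define D where "D = rec_nat \<one> (\<lambda>_ d. \<pi> d \<otimes> d)"
  have D: "D n \<in> carrier R \<and> P (D n)" for n
    by (induction n) (auto simp: D_def one mult \<pi>)
  have "\<exists>n. \<forall>m\<ge>n. PIdl (D m) = PIdl (D n)"
  proof (rule descending_chain_stabilises)
    show "ideal (PIdl (D n)) R" for n using D by (simp add: cgenideal_ideal)
    show "PIdl (D (Suc n)) \<subseteq> PIdl (D n)" for n
    proof (rule cgenideal_minimal)
      show "ideal (PIdl (D n)) R" using D by (simp add: cgenideal_ideal)
      show "D (Suc n) \<in> PIdl (D n)" using D \<pi> by (auto simp: D_def mem_cgenideal_iff)
    qed
  qed
  then obtain n where "PIdl (D (Suc n)) = PIdl (D n)" by (meson le_Suc_eq order_refl)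
  then have "D n \<in> PIdl (D (Suc n))" using cgenideal_self D by auto
  then obtain s where s: "s \<in> carrier R" "D n = s \<otimes> (\<pi> (D n) \<otimes> D n)"
    by (auto simp: mem_cgenideal_iff D_def)
  let ?p = "\<pi> (D n)"
  have p: "?p \<in> carrier R" "maximalideal (PIdl ?p) R" using D \<pi> by auto
  note I = cgenideal_ideal[OF p(1)]
  \<comment> \<open>Stability makes \<open>\<one> \<ominus> s \<otimes> ?p\<close> annihilate
    \<open>D n\<close>. By the choice of \<open>?p\<close> it lies in \<open>(?p)\<close>, and then
    so does \<open>\<one>\<close>.\<close>
  have "(\<one> \<ominus> s \<otimes> ?p) \<otimes> D n = D n \<ominus> s \<otimes> (?p \<otimes> D n)"
    using D s p by (simp add: minus_eq l_distr l_minus m_assoc)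
  also have "\<dots> = \<zero>" using D s(2) by (metis minus_eq r_neg)
  finally have "\<one> \<ominus> s \<otimes> ?p \<in> PIdl ?p" using \<pi>(3)[of "D n"] D s p by auto
  moreover have "s \<otimes> ?p \<in> PIdl ?p" using s by (auto simp: mem_cgenideal_iff)
  ultimately have "(\<one> \<ominus> s \<otimes> ?p) \<oplus> s \<otimes> ?p \<in> PIdl ?p"
    using I by (meson additive_subgroup.a_closed ideal_def)
  moreover have "(\<one> \<ominus> s \<otimes> ?p) \<oplus> s \<otimes> ?p = \<one>"
    using s p by (simp add: minus_eq a_assoc l_neg)
  ultimately show False using one_notin_maximal[OF p(2)] by simp
qed

text \<open>The descending ideals \<open>(p^n)\<close> stabilise. The resulting equation shows that
  an element \<open>x\<close> of \<open>p^n M\<close> with \<open>p x = 0\<close> is zero, since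
  \<open>x = u p x\<close>.\<close>

lemma power_stabilises:
  assumes p: "p \<in> carrier R"
  shows "\<exists>n. \<exists>u\<in>carrier R. p [^] (n::nat) = u \<otimes> (p \<otimes> p [^] n)"
proof -
  have "\<exists>n::nat. \<forall>m\<ge>n. PIdl (p [^] m) = PIdl (p [^] n)"
  proof (rule descending_chain_stabilises)
    show "ideal (PIdl (p [^] n)) R" for n :: nat using p by (simp add: cgenideal_ideal)
    show "PIdl (p [^] Suc n) \<subseteq> PIdl (p [^] n)" for n :: nat
    proof (rule cgenideal_minimal)
      show "ideal (PIdl (p [^] n)) R" using p by (simp add: cgenideal_ideal)
      show "p [^] Suc n \<in> PIdl (p [^] n)" using p by (auto simp: mem_cgenideal_iff m_comm)
    qed
  qed
  then obtain n :: nat where "PIdl (p [^] Suc n) = PIdl (p [^] n)" by (meson le_Suc_eq order_refl)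
  then have "p [^] n \<in> PIdl (p [^] Suc n)" using cgenideal_self[of "p [^] n"] p by auto
  then show ?thesis using p by (auto simp: mem_cgenideal_iff m_comm)
qed

end

section \<open>Reduction of finite generation to kernels of single ring elements\<close>

lemma (in module) submodule_kernel:
  assumes "a \<in> carrier R"
  shows "submodule {x \<in> carrier M. a \<odot>\<^bsub>M\<^esub> x = \<zero>\<^bsub>M\<^esub>} R M"
  using submodule_vimage[OF module_axioms smult_mod_hom[OF assms] submodule_zero_set] by simp

context artinian_pir_module
begin

text \<open>Multiplication by \<open>d\<close> maps the kernel of \<open>p d\<close> into the kernel
  of \<open>p\<close>, and its own kernel is that of \<open>d\<close>. So finite generation passes
  from \<open>d\<close> to \<open>p d\<close>, and finally to \<open>\<zero>\<close>, whose kernel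
  is all of \<open>M\<close>.\<close>

lemma fg_if_kernels_fg:
  assumes "\<And>p. p \<in> carrier R \<Longrightarrow> maximalideal (PIdl p) R \<Longrightarrow>
      fg_submodule {x \<in> carrier M. p \<odot>\<^bsub>M\<^esub> x = \<zero>\<^bsub>M\<^esub>}"
  shows "fg_submodule (carrier M)"
proof -
  have "fg_submodule {x \<in> carrier M. \<zero> \<odot>\<^bsub>M\<^esub> x = \<zero>\<^bsub>M\<^esub>}"
  proof (rule zero_induct_maximal)
    have "{x \<in> carrier M. \<one> \<odot>\<^bsub>M\<^esub> x = \<zero>\<^bsub>M\<^esub>} = {\<zero>\<^bsub>M\<^esub>}" by auto
    then show "fg_submodule {x \<in> carrier M. \<one> \<odot>\<^bsub>M\<^esub> x = \<zero>\<^bsub>M\<^esub>}" using fg_zero by simp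
  next
    fix p d
    assume p: "p \<in> carrier R" "maximalideal (PIdl p) R" and d: "d \<in> carrier R"
      and fg: "fg_submodule {x \<in> carrier M. d \<odot>\<^bsub>M\<^esub> x = \<zero>\<^bsub>M\<^esub>}"
    let ?N = "{x \<in> carrier M. (p \<otimes> d) \<odot>\<^bsub>M\<^esub> x = \<zero>\<^bsub>M\<^esub>}"
    let ?f = "\<lambda>x. d \<odot>\<^bsub>M\<^esub> x"
    note N = submodule_kernel[of "p \<otimes> d", OF R.m_closed[OF p(1) d]]
    have "fg_submodule (?f ` ?N)"
    proof (rule fg_submodule_subset[OF assms[OF p]])
      show "submodule (?f ` ?N) R M"
        by (rule submodule_image[OF module_axioms smult_mod_hom[OF d] N])
      show "?f ` ?N \<subseteq> {x \<in> carrier M. p \<odot>\<^bsub>M\<^esub> x = \<zero>\<^bsub>M\<^esub>}"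
        using p d by (auto simp: smult_assoc1)
    qed
    moreover have "{x \<in> ?N. ?f x = \<zero>\<^bsub>M\<^esub>} = {x \<in> carrier M. d \<odot>\<^bsub>M\<^esub> x = \<zero>\<^bsub>M\<^esub>}"
      using p d by (auto simp: smult_assoc1)
    ultimately show "fg_submodule ?N"
      using fg_submodule_extension[OF module_axioms smult_mod_hom[OF d] _ N refl] fg by simp
  qed
  moreover have "{x \<in> carrier M. \<zero> \<odot>\<^bsub>M\<^esub> x = \<zero>\<^bsub>M\<^esub>} = carrier M" by auto
  ultimately show ?thesis by simp
qed

end

section \<open>Maps given by graphs, and complements of submodules\<close>

context module
begin

text \<open>Two values at one point differ by a value at zero, so it is enough that the relation is
  single valued there. A graph avoids choosing among several representations of an element.\<close>

lemma mod_hom_of_graph: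
  assumes "module R N" and G: "G \<subseteq> carrier M \<times> carrier N"
    and add: "\<And>x y x' y'. (x, y) \<in> G \<Longrightarrow> (x', y') \<in> G \<Longrightarrow> (x \<oplus>\<^bsub>M\<^esub> x', y \<oplus>\<^bsub>N\<^esub> y') \<in> G"
    and smult: "\<And>r x y. r \<in> carrier R \<Longrightarrow> (x, y) \<in> G \<Longrightarrow> (r \<odot>\<^bsub>M\<^esub> x, r \<odot>\<^bsub>N\<^esub> y) \<in> G"
    and total: "\<And>x. x \<in> carrier M \<Longrightarrow> \<exists>y. (x, y) \<in> G"
    and zero: "\<And>y. (\<zero>\<^bsub>M\<^esub>, y) \<in> G \<Longrightarrow> y = \<zero>\<^bsub>N\<^esub>"
  obtains h where "h \<in> mod_hom R M N" "\<And>x y. (x, y) \<in> G \<Longrightarrow> h x = y"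
proof -
  interpret N: module R N by fact
  have unique: "y = y'" if "(x, y) \<in> G" "(x, y') \<in> G" for x y y'
  proof -
    have c: "x \<in> carrier M" "y \<in> carrier N" "y' \<in> carrier N" using that G by auto
    have "(x \<oplus>\<^bsub>M\<^esub> (\<ominus> \<one>) \<odot>\<^bsub>M\<^esub> x, y \<oplus>\<^bsub>N\<^esub> (\<ominus> \<one>) \<odot>\<^bsub>N\<^esub> y') \<in> G"
      by (rule add[OF that(1) smult[OF _ that(2)]]) simp
    then have "(\<zero>\<^bsub>M\<^esub>, y \<ominus>\<^bsub>N\<^esub> y') \<in> G"
      using c by (simp add: smult_l_minus N.smult_l_minus M.r_neg N.M.minus_eq)
    then have "y \<ominus>\<^bsub>N\<^esub> y' = \<zero>\<^bsub>N\<^esub>" by (rule zero)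
    then show ?thesis using N.minus_add_cancel[OF c(2,3)] c by simp
  qed
  obtain h where h: "\<And>x. x \<in> carrier M \<Longrightarrow> (x, h x) \<in> G" using total by metis
  have eq: "h x = y" if "(x, y) \<in> G" for x y using unique[OF h that] that G by auto
  have "h \<in> mod_hom R M N"
    unfolding mod_hom_def using h G by (auto intro!: eq add smult)
  then show ?thesis using that eq by blast
qed

text \<open>\<open>N\<close> is maximal among the submodules containing \<open>D\<close> that meet \<open>C\<close> trivially. For \<open>y\<close> outside
  \<open>N + C\<close>, some \<open>p\<^sup>k y\<close> corrected by an element of \<open>C\<close> is a \<open>z'\<close> outside \<open>N + C\<close> with \<open>p z' \<in> N\<close>,
  and adjoining \<open>z'\<close> to \<open>N\<close> contradicts maximality.\<close>

lemma exists_complement: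
  assumes p: "p \<in> carrier R" "maximalideal (PIdl p) R"
    and C: "submodule C R M" and D: "submodule D R M" and CD: "D \<inter> C = {\<zero>\<^bsub>M\<^esub>}"
    and pD: "\<And>y. y \<in> carrier M \<Longrightarrow> p [^] Suc i \<odot>\<^bsub>M\<^esub> y \<in> D"
    and pC: "\<And>c. c \<in> C \<Longrightarrow> p [^] i \<odot>\<^bsub>M\<^esub> c = \<zero>\<^bsub>M\<^esub> \<Longrightarrow> \<exists>c'\<in>C. c = p \<odot>\<^bsub>M\<^esub> c'"
  obtains N where "submodule N R M" "N \<inter> C = {\<zero>\<^bsub>M\<^esub>}"
    "\<And>y. y \<in> carrier M \<Longrightarrow> \<exists>n\<in>N. \<exists>c\<in>C. y = n \<oplus>\<^bsub>M\<^esub> c"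
proof -
  let ?A = "{N. submodule N R M \<and> D \<subseteq> N \<and> N \<inter> C = {\<zero>\<^bsub>M\<^esub>}}"
  have "\<exists>N\<in>?A. \<forall>H\<in>?A. N \<subseteq> H \<longrightarrow> H = N"
  proof (rule subset_Zorn_nonempty)
    show "?A \<noteq> {}" using D CD by auto
    fix F assume F: "F \<noteq> {}" "subset.chain ?A F"
    have sm: "submodule N R M" "D \<subseteq> N" "N \<inter> C = {\<zero>\<^bsub>M\<^esub>}" if "N \<in> F" for N
      using F(2) that unfolding subset_chain_def by auto
    have "submodule (\<Union>F) R M"
    proof (rule submoduleI_smult)
      show "\<Union>F \<subseteq> carrier M" using submoduleE(1)[OF sm(1)] by blast
      show "\<zero>\<^bsub>M\<^esub> \<in> \<Union>F" using submodule_zero[OF sm(1)] F(1) by blast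
      show "a \<odot>\<^bsub>M\<^esub> x \<in> \<Union>F" if "a \<in> carrier R" "x \<in> \<Union>F" for a x
        using submoduleE(4)[OF sm(1)] that by blast
      show "a \<oplus>\<^bsub>M\<^esub> b \<in> \<Union>F" if ab: "a \<in> \<Union>F" "b \<in> \<Union>F" for a b
      proof -
        obtain N where "N \<in> F" "a \<in> N" "b \<in> N"
          using ab F(2) unfolding subset_chain_def by blast
        then show ?thesis using submoduleE(5)[OF sm(1)] by blast
      qed
    qed
    moreover have "\<Union>F \<inter> C = {\<zero>\<^bsub>M\<^esub>}" using F(1) sm(3) by blast
    ultimately show "\<Union>F \<in> ?A" using F(1) sm(2) by blast
  qed
  then obtain N where N: "submodule N R M" "D \<subseteq> N" "N \<inter> C = {\<zero>\<^bsub>M\<^esub>}"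
    and max: "\<And>H. submodule H R M \<Longrightarrow> D \<subseteq> H \<Longrightarrow> H \<inter> C = {\<zero>\<^bsub>M\<^esub>} \<Longrightarrow> N \<subseteq> H \<Longrightarrow> H = N"
    by auto
  note NE = submoduleE[OF N(1)] submodule_zero[OF N(1)]
  note CE = submoduleE[OF C] submodule_zero[OF C]
  have NM: "x \<in> carrier M" if "x \<in> N" for x using that NE(1) by auto
  have CM: "x \<in> carrier M" if "x \<in> C" for x using that CE(1) by auto
  define W where "W = {n \<oplus>\<^bsub>M\<^esub> c | n c. n \<in> N \<and> c \<in> C}"
  have WI: "n \<oplus>\<^bsub>M\<^esub> c \<in> W" if "n \<in> N" "c \<in> C" for n c using that by (auto simp: W_def)
  have NW: "N \<subseteq> W"
  proof
    fix x assume "x \<in> N"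
    then show "x \<in> W" using WI[of x "\<zero>\<^bsub>M\<^esub>"] CE NM by auto
  qed
  have "y \<in> W" if y: "y \<in> carrier M" for y
  proof (rule ccontr)
    assume "y \<notin> W"
    then have "\<not> p [^] (0::nat) \<odot>\<^bsub>M\<^esub> y \<in> W" using y by simp
    moreover have "p [^] Suc i \<odot>\<^bsub>M\<^esub> y \<in> W" using pD[OF y] N(2) NW by auto
    ultimately obtain k where k: "p [^] k \<odot>\<^bsub>M\<^esub> y \<notin> W" "p [^] Suc k \<odot>\<^bsub>M\<^esub> y \<in> W"
      using ex_least_nat_less[of "\<lambda>k. p [^] k \<odot>\<^bsub>M\<^esub> y \<in> W" "Suc i"] by blast
    define z where "z = p [^] k \<odot>\<^bsub>M\<^esub> y"
    have z: "z \<in> carrier M" "z \<notin> W" using k(1) y p by (auto simp: z_def)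
    have "p \<odot>\<^bsub>M\<^esub> z \<in> W"
      using k(2) y p by (simp add: z_def smult_assoc1[symmetric] R.m_comm)
    then obtain n c where nc: "n \<in> N" "c \<in> C" "p \<odot>\<^bsub>M\<^esub> z = n \<oplus>\<^bsub>M\<^esub> c"
      by (auto simp: W_def)
    have cM: "n \<in> carrier M" "c \<in> carrier M" using nc NM CM by auto
    \<comment> \<open>Multiplying \<open>p z = n + c\<close> by \<open>p^i\<close> shows that
      \<open>p^i c\<close> lies in \<open>N\<close> as well as in \<open>C\<close>, because
      \<open>p^(i+1) z\<close> lies in \<open>D\<close>. Hence it vanishes, and \<open>pC\<close>
      divides \<open>c\<close> by \<open>p\<close> inside \<open>C\<close>.\<close>
    have "p [^] Suc i \<odot>\<^bsub>M\<^esub> z = p [^] i \<odot>\<^bsub>M\<^esub> n \<oplus>\<^bsub>M\<^esub> p [^] i \<odot>\<^bsub>M\<^esub> c"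
      using nc cM z p by (simp add: smult_assoc1 smult_r_distr)
    then have "p [^] i \<odot>\<^bsub>M\<^esub> c = p [^] Suc i \<odot>\<^bsub>M\<^esub> z \<ominus>\<^bsub>M\<^esub> p [^] i \<odot>\<^bsub>M\<^esub> n"
      using cM p by (simp add: M.minus_eq M.a_ac M.r_neg M.r_neg1 M.r_neg2)
    moreover have "\<dots> \<in> N"
      using submodule_minus[OF N(1)] pD[OF z(1)] N(2) NE(4) nc p by auto
    moreover have "p [^] i \<odot>\<^bsub>M\<^esub> c \<in> C" using CE(4) nc p by auto
    ultimately have "p [^] i \<odot>\<^bsub>M\<^esub> c = \<zero>\<^bsub>M\<^esub>" using N(3) by auto
    then obtain c' where c': "c' \<in> C" "c = p \<odot>\<^bsub>M\<^esub> c'" using pC nc by blast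
    define z' where "z' = z \<ominus>\<^bsub>M\<^esub> c'"
    have z'M: "z' \<in> carrier M" using z c' CM by (auto simp: z'_def)
    have z'z: "z = z' \<oplus>\<^bsub>M\<^esub> c'" unfolding z'_def using minus_add_cancel z c' CM by simp
    have "n \<oplus>\<^bsub>M\<^esub> c = p \<odot>\<^bsub>M\<^esub> z' \<oplus>\<^bsub>M\<^esub> c"
      using nc(3) c' CM z'M p unfolding z'z by (simp add: smult_r_distr)
    then have pz': "p \<odot>\<^bsub>M\<^esub> z' = n" using cM z'M p M.add.r_cancel[of c n "p \<odot>\<^bsub>M\<^esub> z'"] by simp
    have z'W: "z' \<notin> W"
    proof
      assume "z' \<in> W"
      then obtain m d where "m \<in> N" "d \<in> C" "z' = m \<oplus>\<^bsub>M\<^esub> d" by (auto simp: W_def)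
      then have "z = m \<oplus>\<^bsub>M\<^esub> (d \<oplus>\<^bsub>M\<^esub> c')" "d \<oplus>\<^bsub>M\<^esub> c' \<in> C"
        using z'z c' CM NM CE(5) by (auto simp: M.a_assoc)
      then show False using z(2) WI \<open>m \<in> N\<close> by auto
    qed
    let ?H = "adjoin N z'"
    note H = submodule_adjoin[OF N(1) z'M]
    have "N \<subseteq> ?H" "z' \<in> ?H" using adjoin_superset[OF N(1) z'M] adjoin_self[OF N(1) z'M] by auto
    moreover have "?H \<noteq> N" using \<open>z' \<in> ?H\<close> z'W NW by auto
    ultimately have "?H \<inter> C \<noteq> {\<zero>\<^bsub>M\<^esub>}" using max[OF H] N(2) by auto
    then obtain e where e: "e \<in> ?H" "e \<in> C" "e \<noteq> \<zero>\<^bsub>M\<^esub>"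
      using submodule_zero[OF H] CE(7) by auto
    then obtain m r where mr: "m \<in> N" "r \<in> carrier R" "e = m \<oplus>\<^bsub>M\<^esub> r \<odot>\<^bsub>M\<^esub> z'"
      by (auto simp: adjoin_def)
    \<comment> \<open>If \<open>p\<close> divides \<open>r\<close>, then \<open>r z'\<close> is a
      multiple of \<open>n\<close> and the nonzero \<open>e\<close> falls into \<open>N\<close>.
      Otherwise \<open>r\<close> is invertible modulo \<open>p\<close>, and \<open>z'\<close> itself
      falls into \<open>W\<close>.\<close>
    show False
    proof (cases "r \<in> PIdl p")
      case True
      then obtain s where s: "s \<in> carrier R" "r = s \<otimes> p" by (auto simp: cgenideal_def)
      then have "r \<odot>\<^bsub>M\<^esub> z' = s \<odot>\<^bsub>M\<^esub> n" using p z'M pz' by (simp add: smult_assoc1)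
      then have "e \<in> N" using mr NE s nc by simp
      then show False using e N(3) by auto
    next
      case False
      then obtain a b where ab: "a \<in> carrier R" "b \<in> carrier R" "a \<otimes> r \<oplus> b \<otimes> p = \<one>"
        using R.maximal_cgenideal_bezout[OF p mr(2)] by blast
      have rz': "r \<odot>\<^bsub>M\<^esub> z' = e \<ominus>\<^bsub>M\<^esub> m"
        using mr NM z'M by (simp add: M.minus_eq M.a_ac M.r_neg M.r_neg1 M.r_neg2)
      have "z' = (a \<otimes> r \<oplus> b \<otimes> p) \<odot>\<^bsub>M\<^esub> z'" using ab z'M by simp
      also have "\<dots> = a \<odot>\<^bsub>M\<^esub> (r \<odot>\<^bsub>M\<^esub> z') \<oplus>\<^bsub>M\<^esub> b \<odot>\<^bsub>M\<^esub> (p \<odot>\<^bsub>M\<^esub> z')"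
        using ab(1,2) p mr(2) z'M by (simp add: smult_l_distr smult_assoc1)
      finally have "z' = a \<odot>\<^bsub>M\<^esub> (e \<ominus>\<^bsub>M\<^esub> m) \<oplus>\<^bsub>M\<^esub> b \<odot>\<^bsub>M\<^esub> n" unfolding rz' pz' .
      then have "z' = (b \<odot>\<^bsub>M\<^esub> n \<ominus>\<^bsub>M\<^esub> a \<odot>\<^bsub>M\<^esub> m) \<oplus>\<^bsub>M\<^esub> a \<odot>\<^bsub>M\<^esub> e"
        using ab mr e CM NM cM by (simp add: M.minus_eq smult_r_distr smult_r_minus M.a_ac)
      then show False
        using z'W WI[OF submodule_minus[OF N(1) NE(4)[OF ab(2) nc(1)] NE(4)[OF ab(1) mr(1)]]
            CE(4)[OF ab(1) e(2)]] by simp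
    qed
  qed
  then have "\<exists>n\<in>N. \<exists>c\<in>C. y = n \<oplus>\<^bsub>M\<^esub> c" if "y \<in> carrier M" for y
    using that unfolding W_def by blast
  then show ?thesis using that N by blast
qed

end

subsection \<open>Shift endomorphisms\<close>

context module
begin

section \<open>Finite linear combinations of a sequence\<close>

text \<open>Vectors and coefficients are infinite sequences cut off at an explicit length, so that
  combinations of different lengths can be padded and indices shifted.\<close>

primrec lincomb where
  "lincomb x r 0 = \<zero>\<^bsub>M\<^esub>"
| "lincomb x r (Suc m) = lincomb x r m \<oplus>\<^bsub>M\<^esub> r m \<odot>\<^bsub>M\<^esub> x m"

lemma lincomb_in_submodule:
  assumes "submodule N R M" "\<And>j. j < m \<Longrightarrow> r j \<in> carrier R" "\<And>j. j < m \<Longrightarrow> x j \<in> N"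
  shows "lincomb x r m \<in> N"
  using assms(2,3)
  by (induction m) (auto simp: submodule_zero[OF assms(1)] intro!: submoduleE(4,5)[OF assms(1)])

lemma lincomb_closed:
  assumes "\<And>j. j < m \<Longrightarrow> r j \<in> carrier R" "\<And>j. j < m \<Longrightarrow> x j \<in> carrier M"
  shows "lincomb x r m \<in> carrier M"
  using lincomb_in_submodule[OF carrier_is_submodule] assms by simp

text \<open>Only the products are compared, so a scalar may move from the coefficients into the
  vectors.\<close>

lemma lincomb_cong:
  assumes "\<And>j. j < m \<Longrightarrow> r j \<odot>\<^bsub>M\<^esub> x j = s j \<odot>\<^bsub>M\<^esub> y j"
  shows "lincomb x r m = lincomb y s m"
  using assms by (induction m) auto

lemma lincomb_add:
  assumes "\<And>j. j < m \<Longrightarrow> r j \<in> carrier R" "\<And>j. j < m \<Longrightarrow> s j \<in> carrier R"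
    and "\<And>j. j < m \<Longrightarrow> x j \<in> carrier M"
  shows "lincomb x (\<lambda>j. r j \<oplus> s j) m = lincomb x r m \<oplus>\<^bsub>M\<^esub> lincomb x s m"
  using assms
proof (induction m)
  case (Suc m)
  then have "lincomb x r m \<in> carrier M" "lincomb x s m \<in> carrier M"
    by (auto intro!: lincomb_closed)
  then show ?case using Suc by (simp add: smult_l_distr M.a_ac)
qed simp

lemma lincomb_smult:
  assumes "a \<in> carrier R" "\<And>j. j < m \<Longrightarrow> r j \<in> carrier R" "\<And>j. j < m \<Longrightarrow> x j \<in> carrier M"
  shows "lincomb x (\<lambda>j. a \<otimes> r j) m = a \<odot>\<^bsub>M\<^esub> lincomb x r m"
  using assms(2,3)
proof (induction m)
  case (Suc m)
  then have "lincomb x r m \<in> carrier M" by (auto intro!: lincomb_closed)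
  then show ?case using Suc assms(1) by (simp add: smult_r_distr smult_assoc1)
qed (simp add: assms)

lemma lincomb_pad:
  assumes "\<And>j. j < m \<Longrightarrow> r j \<in> carrier R" "\<And>j. x j \<in> carrier M" "m \<le> k"
  shows "lincomb x (\<lambda>j. if j < m then r j else \<zero>) k = lincomb x r m"
  using assms(3)
proof (induction k rule: dec_induct)
  case base
  show ?case by (rule lincomb_cong) simp
next
  case (step k)
  then show ?case using assms lincomb_closed[of m r x] by simp
qed

text \<open>The coefficients \<open>t\<close> must not depend on \<open>x\<close>: the graph of the shift uses the same coefficients
  for a sequence and for its shifted copy.\<close>

lemma lincomb_add_pad:
  assumes "\<And>j. j < m \<Longrightarrow> r j \<in> carrier R" "\<And>j. j < k \<Longrightarrow> s j \<in> carrier R"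
  obtains t l where "\<And>j. t j \<in> carrier R"
    "\<And>x. (\<And>j. x j \<in> carrier M) \<Longrightarrow> lincomb x t l = lincomb x r m \<oplus>\<^bsub>M\<^esub> lincomb x s k"
proof -
  let ?r = "\<lambda>j. if j < m then r j else \<zero>" and ?s = "\<lambda>j. if j < k then s j else \<zero>"
  show ?thesis
  proof (rule that[of "\<lambda>j. ?r j \<oplus> ?s j" "max m k"])
    show "?r j \<oplus> ?s j \<in> carrier R" for j using assms by auto
    show "lincomb x (\<lambda>j. ?r j \<oplus> ?s j) (max m k) = lincomb x r m \<oplus>\<^bsub>M\<^esub> lincomb x s k"
      if "\<And>j. x j \<in> carrier M" for x
      using lincomb_add[of "max m k" ?r ?s x] lincomb_pad[of m r x "max m k"]
        lincomb_pad[of k s x "max m k"] assms that by simp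
  qed
qed

text \<open>Prepending zero to the vectors is the backward shift
  \<open>x (Suc j) \<mapsto> x j\<close>; prepending zero to the coefficients undoes it. This is
  what makes the shift surjective.\<close>

lemma lincomb_shift:
  "lincomb (case_nat \<zero>\<^bsub>M\<^esub> x) (case_nat \<zero> r) (Suc m) = lincomb x r m"
  by (induction m) auto

lemma lincomb_coeff_in_maximal:
  assumes p: "p \<in> carrier R" "maximalideal (PIdl p) R"
    and v: "\<And>j. v j \<in> carrier M" "\<And>j. p \<odot>\<^bsub>M\<^esub> v j = \<zero>\<^bsub>M\<^esub>"
    and N: "submodule (N 0) R M" "\<And>j. N (Suc j) = adjoin (N j) (v j)" "\<And>j. v j \<notin> N j"
    and r: "\<And>j. r j \<in> carrier R" "lincomb v r m \<in> N 0"
  shows "\<forall>j<m. r j \<in> PIdl p"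
  using r(2)
proof (induction m)
  case (Suc m)
  have sm: "submodule (N j) R M" for j
    by (induction j) (auto simp: N submodule_adjoin v)
  have sub: "N i \<subseteq> N j" if "i \<le> j" for i j
    using lift_Suc_mono_le[of N i j] adjoin_superset[OF sm v(1)] N(2) that by simp
  have "v j \<in> N m" if "j < m" for j
    using adjoin_self[OF sm v(1), of j j] sub[of "Suc j" m] that N(2)[of j] by auto
  then have lm: "lincomb v r m \<in> N m" using r(1) by (intro lincomb_in_submodule[OF sm]) auto
  have lM: "lincomb v r m \<in> carrier M" by (rule lincomb_closed) (use r v in auto)
  have "lincomb v r m \<oplus>\<^bsub>M\<^esub> r m \<odot>\<^bsub>M\<^esub> v m \<in> N m" using Suc.prems sub[of 0 m] by auto
  from submodule_minus[OF sm this lm] have rv: "r m \<odot>\<^bsub>M\<^esub> v m \<in> N m"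
    using add_minus_cancel_left[OF lM, of "r m \<odot>\<^bsub>M\<^esub> v m"] r v by simp
  have rm: "r m \<in> PIdl p"
  proof (rule ccontr)
    assume "r m \<notin> PIdl p"
    then obtain a b where ab: "a \<in> carrier R" "b \<in> carrier R" "a \<otimes> r m \<oplus> b \<otimes> p = \<one>"
      using R.maximal_cgenideal_bezout[OF p r(1)] by blast
    have "v m = (a \<otimes> r m \<oplus> b \<otimes> p) \<odot>\<^bsub>M\<^esub> v m" using ab v by simp
    also have "\<dots> = a \<odot>\<^bsub>M\<^esub> (r m \<odot>\<^bsub>M\<^esub> v m)"
      using ab(1,2) p r(1) v by (simp add: smult_l_distr smult_assoc1)
    finally show False using submoduleE(4)[OF sm ab(1) rv] N(3) by metis
  qed
  then obtain s where "s \<in> carrier R" "r m = s \<otimes> p" by (auto simp: R.mem_cgenideal_iff)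
  then have "r m \<odot>\<^bsub>M\<^esub> v m = \<zero>\<^bsub>M\<^esub>" using p v by (simp add: smult_assoc1)
  then have "lincomb v r m \<in> N 0" using Suc.prems lM by simp
  then show ?case using Suc.IH rm less_Suc_eq by auto
qed simp

section \<open>Independent sequences and the shift they carry\<close>

text \<open>No finitely generated submodule exhausts \<open>V\<close>, so starting from
  \<open>K\<close> one can always choose a further vector of \<open>V\<close> outside the span
  reached so far. The result is independent over \<open>R/(p)\<close> modulo
  \<open>K\<close>.\<close>

lemma exists_independent_sequence:
  assumes p: "p \<in> carrier R" "maximalideal (PIdl p) R"
    and V: "submodule V R M" "\<And>v. v \<in> V \<Longrightarrow> p \<odot>\<^bsub>M\<^esub> v = \<zero>\<^bsub>M\<^esub>" "\<not> fg_submodule V"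
    and K: "fg_submodule K" "K \<subseteq> V"
  obtains v :: "nat \<Rightarrow> _" where "\<And>j. v j \<in> V"
    "\<And>r m. (\<And>j. r j \<in> carrier R) \<Longrightarrow> lincomb v r m \<in> K \<Longrightarrow> \<forall>j<m. r j \<in> PIdl p"
proof -
  have VM: "v \<in> carrier M" if "v \<in> V" for v using that submoduleE(1)[OF V(1)] by auto
  have "\<exists>c. c \<in> V \<and> c \<notin> N" if "fg_submodule N" "N \<subseteq> V" for N
    using that V(3) by (metis subsetI subset_antisym)
  then obtain c where c: "\<And>N. fg_submodule N \<Longrightarrow> N \<subseteq> V \<Longrightarrow> c N \<in> V"
    "\<And>N. fg_submodule N \<Longrightarrow> N \<subseteq> V \<Longrightarrow> c N \<notin> N" by metis
  define N where "N = rec_nat K (\<lambda>_ N. adjoin N (c N))"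
  have N_simps: "N 0 = K" "N (Suc j) = adjoin (N j) (c (N j))" for j by (simp_all add: N_def)
  have N: "fg_submodule (N j) \<and> N j \<subseteq> V" for j
  proof (induction j)
    case (Suc j)
    then have "c (N j) \<in> V" using c(1) by simp
    then show ?case unfolding N_simps using Suc VM fg_adjoin adjoin_least[OF V(1)] by auto
  qed (use K in \<open>simp add: N_simps\<close>)
  show ?thesis
  proof (rule that[of "\<lambda>j. c (N j)"])
    show "c (N j) \<in> V" for j using N c by auto
    fix r :: "nat \<Rightarrow> 'a" and m
    assume r: "\<And>j. r j \<in> carrier R" "lincomb (\<lambda>j. c (N j)) r m \<in> K"
    show "\<forall>j<m. r j \<in> PIdl p"
    proof (rule lincomb_coeff_in_maximal[OF p, where N = N and v = "\<lambda>j. c (N j)"])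
      show "submodule (N 0) R M" using N fg_submodule_imp_submodule by blast
      show "N (Suc j) = adjoin (N j) (c (N j))" for j by (rule N_simps)
      show "c (N j) \<notin> N j" "c (N j) \<in> carrier M" "p \<odot>\<^bsub>M\<^esub> c (N j) = \<zero>\<^bsub>M\<^esub>" for j
        using N[of j] c[of "N j"] VM V(2) by auto
    qed (use r in \<open>auto simp: N_simps\<close>)
  qed
qed

lemma pow_smult_Suc:
  assumes "p \<in> carrier R" "x \<in> carrier M"
  shows "p [^] Suc i \<odot>\<^bsub>M\<^esub> x = p \<odot>\<^bsub>M\<^esub> (p [^] i \<odot>\<^bsub>M\<^esub> x)"
  using assms by (simp add: smult_assoc1[symmetric] R.m_comm)

text \<open>Suppose \<open>r j = s j \<otimes> p [^] k\<close> with \<open>k \<le> i\<close>.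
  Multiplying the combination by \<open>p^(i-k)\<close> turns it into one of the
  \<open>p^i x j\<close> with coefficients \<open>s j\<close>. Independence puts these into
  \<open>(p)\<close>, which raises \<open>k\<close> by one; the last round is
  \<open>k = i\<close>.\<close>

lemma lincomb_coeff_in_power:
  assumes p: "p \<in> carrier R" and x: "\<And>j. x j \<in> carrier M"
    and D: "submodule D R M"
    and indep: "\<And>s m. (\<And>j. s j \<in> carrier R) \<Longrightarrow> lincomb (\<lambda>j. p [^] i \<odot>\<^bsub>M\<^esub> x j) s m \<in> D
      \<Longrightarrow> \<forall>j<m. s j \<in> PIdl p"
    and r: "\<And>j. r j \<in> carrier R" "lincomb x r m \<in> D"
  shows "k \<le> Suc i \<Longrightarrow> \<forall>j<m. r j \<in> PIdl (p [^] k)"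
proof (induction k)
  case 0
  then show ?case using r by (auto simp: R.mem_cgenideal_iff)
next
  case (Suc k)
  then have "\<forall>j. \<exists>t\<in>carrier R. j < m \<longrightarrow> r j = t \<otimes> p [^] k"
    by (auto simp: R.mem_cgenideal_iff)
  then obtain s where s: "\<And>j. s j \<in> carrier R" "\<And>j. j < m \<Longrightarrow> r j = s j \<otimes> p [^] k" by metis
  have "p [^] (i - k) \<odot>\<^bsub>M\<^esub> lincomb x r m = lincomb x (\<lambda>j. p [^] (i - k) \<otimes> r j) m"
    using lincomb_smult[of "p [^] (i - k)" m r x] p x r by simp
  also have "\<dots> = lincomb (\<lambda>j. p [^] i \<odot>\<^bsub>M\<^esub> x j) s m"
  proof (rule lincomb_cong)
    fix j assume "j < m"
    then have "p [^] (i - k) \<otimes> r j = s j \<otimes> (p [^] (i - k) \<otimes> p [^] k)"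
      using s p by (simp add: R.m_ac)
    also have "p [^] (i - k) \<otimes> p [^] k = p [^] i"
      using Suc.prems p by (simp add: R.nat_pow_mult)
    finally show "(p [^] (i - k) \<otimes> r j) \<odot>\<^bsub>M\<^esub> x j = s j \<odot>\<^bsub>M\<^esub> (p [^] i \<odot>\<^bsub>M\<^esub> x j)"
      using s p x by (simp add: smult_assoc1)
  qed
  finally have "lincomb (\<lambda>j. p [^] i \<odot>\<^bsub>M\<^esub> x j) s m \<in> D"
    using submoduleE(4)[OF D _ r(2), of "p [^] (i - k)"] p by simp
  then have sp: "\<forall>j<m. s j \<in> PIdl p" using indep s by blast
  show ?case
  proof (intro allI impI)
    fix j assume j: "j < m"
    then obtain t where "t \<in> carrier R" "s j = t \<otimes> p" using sp by (auto simp: R.mem_cgenideal_iff)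
    then show "r j \<in> PIdl (p [^] Suc k)"
      using s(2)[OF j] p by (auto simp: R.mem_cgenideal_iff R.m_ac intro!: bexI[of _ t])
  qed
qed

text \<open>The \<open>p^i x j\<close> are independent over \<open>R/(p)\<close> modulo
  \<open>p^(i+1) M\<close>. This makes the span of the \<open>x j\<close> free over
  \<open>R/(p^(i+1))\<close> and a direct summand. The identity on a complement plus the backward
  shift on the span is surjective but kills \<open>x 0\<close>.\<close>

lemma independent_imp_not_hopfian:
  assumes p: "p \<in> carrier R" "maximalideal (PIdl p) R"
    and x: "\<And>j::nat. x j \<in> carrier M" "\<And>j. p [^] Suc i \<odot>\<^bsub>M\<^esub> x j = \<zero>\<^bsub>M\<^esub>"
    and indep: "\<And>s m. (\<And>j. s j \<in> carrier R) \<Longrightarrow>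
      lincomb (\<lambda>j. p [^] i \<odot>\<^bsub>M\<^esub> x j) s m \<in> (\<lambda>y. p [^] Suc i \<odot>\<^bsub>M\<^esub> y) ` carrier M
      \<Longrightarrow> \<forall>j<m. s j \<in> PIdl p"
  shows "\<not> hopfian R M"
proof
  assume hopf: "hopfian R M"
  define D where "D = (\<lambda>y. p [^] Suc i \<odot>\<^bsub>M\<^esub> y) ` carrier M"
  have pi: "p [^] k \<in> carrier R" for k :: nat using p by simp
  have D: "submodule D R M"
    unfolding D_def by (rule submodule_image[OF module_axioms smult_mod_hom[OF pi] carrier_is_submodule])
  define C where "C = {lincomb x r m | r m. \<forall>j. r j \<in> carrier R}"
  have CI: "lincomb x r m \<in> C" if "\<And>j. r j \<in> carrier R" for r m using that by (auto simp: C_def)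
  have C: "submodule C R M"
  proof (rule submoduleI_smult)
    show "C \<subseteq> carrier M" unfolding C_def using x lincomb_closed by blast
    show "\<zero>\<^bsub>M\<^esub> \<in> C" using CI[of "\<lambda>_. \<zero>" 0] by simp
    show "a \<oplus>\<^bsub>M\<^esub> b \<in> C" if ab: "a \<in> C" "b \<in> C" for a b
    proof -
      obtain r m s k where rs: "\<forall>j. r j \<in> carrier R" "\<forall>j. s j \<in> carrier R"
        "a = lincomb x r m" "b = lincomb x s k" using ab by (auto simp: C_def)
      obtain t l where "\<And>j. t j \<in> carrier R"
        "\<And>x. (\<And>j. x j \<in> carrier M) \<Longrightarrow> lincomb x t l = lincomb x r m \<oplus>\<^bsub>M\<^esub> lincomb x s k"
        using lincomb_add_pad[of m r k s] rs(1,2) by blast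
      then show ?thesis using CI[of t l] rs x(1) by simp
    qed
    show "a \<odot>\<^bsub>M\<^esub> c \<in> C" if ac: "a \<in> carrier R" "c \<in> C" for a c
    proof -
      obtain r m where rs: "\<forall>j. r j \<in> carrier R" "c = lincomb x r m" using ac by (auto simp: C_def)
      then show ?thesis
        using CI[of "\<lambda>j. a \<otimes> r j" m] lincomb_smult[of a m r x] ac(1) x(1) by simp
    qed
  qed
  \<comment> \<open>Independence lifts from the \<open>p^i x j\<close> to the \<open>x j\<close>: a
    combination lies in \<open>D\<close> only if \<open>p^(i+1)\<close> divides all its
    coefficients.\<close>
  have coeff: "\<forall>j<m. r j \<in> PIdl (p [^] Suc i)" if "\<And>j. r j \<in> carrier R" "lincomb x r m \<in> D" for r m
    by (rule lincomb_coeff_in_power[OF p(1) x(1) D _ that]) (use indep in \<open>auto simp: D_def\<close>)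
  \<comment> \<open>Stated for an arbitrary family because it is applied both to \<open>x\<close>
    and to its shifted copy.\<close>
  have kill: "lincomb y r m = \<zero>\<^bsub>M\<^esub>"
    if r: "\<forall>j<m. r j \<in> PIdl (p [^] Suc i)" and y: "\<And>j. y j \<in> carrier M" "\<And>j. p [^] Suc i \<odot>\<^bsub>M\<^esub> y j = \<zero>\<^bsub>M\<^esub>"
    for y r m
    using r
  proof (induction m)
    case (Suc m)
    then obtain t where "t \<in> carrier R" "r m = t \<otimes> p [^] Suc i" by (auto simp: R.mem_cgenideal_iff)
    then have "r m \<odot>\<^bsub>M\<^esub> y m = \<zero>\<^bsub>M\<^esub>" using smult_assoc1[of t "p [^] Suc i" "y m"] y pi[of "Suc i"] by simp
    then show ?case using Suc by simp
  qed simp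
  have DC: "D \<inter> C = {\<zero>\<^bsub>M\<^esub>}"
  proof -
    have "c = \<zero>\<^bsub>M\<^esub>" if c: "c \<in> D" "c \<in> C" for c
    proof -
      obtain r m where r: "\<And>j. r j \<in> carrier R" "c = lincomb x r m"
        using c(2) by (auto simp: C_def)
      have "\<forall>j<m. r j \<in> PIdl (p [^] Suc i)" by (rule coeff) (use r c(1) in auto)
      then show ?thesis unfolding r(2) by (rule kill[OF _ x])
    qed
    then show ?thesis using submodule_zero[OF C] submodule_zero[OF D] by blast
  qed
  \<comment> \<open>If \<open>p^i\<close> kills \<open>c\<close>, independence makes all its
    coefficients multiples of \<open>p\<close>, and this \<open>p\<close> can be taken out in
    front.\<close>
  have pC: "\<exists>c'\<in>C. c = p \<odot>\<^bsub>M\<^esub> c'" if c: "c \<in> C" "p [^] i \<odot>\<^bsub>M\<^esub> c = \<zero>\<^bsub>M\<^esub>" for c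
  proof -
    obtain r m where r: "\<And>j. r j \<in> carrier R" "c = lincomb x r m" using c by (auto simp: C_def)
    have "lincomb (\<lambda>j. p [^] i \<odot>\<^bsub>M\<^esub> x j) r m = lincomb x (\<lambda>j. p [^] i \<otimes> r j) m"
      using r pi x by (intro lincomb_cong) (simp add: smult_assoc1[symmetric] R.m_comm)
    also have "\<dots> = \<zero>\<^bsub>M\<^esub>" using lincomb_smult[of "p [^] i" m r x] r pi x c by simp
    finally have "\<forall>j<m. r j \<in> PIdl p" using indep[of r m] r submodule_zero[OF D] by (simp add: D_def)
    then have "\<forall>j. \<exists>t\<in>carrier R. j < m \<longrightarrow> r j = t \<otimes> p" by (auto simp: R.mem_cgenideal_iff)
    then obtain t where t: "\<And>j. t j \<in> carrier R" "\<And>j. j < m \<Longrightarrow> r j = t j \<otimes> p" by metis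
    have "c = lincomb x (\<lambda>j. p \<otimes> t j) m"
      unfolding r(2) using t p by (intro lincomb_cong) (simp add: R.m_comm)
    also have "\<dots> = p \<odot>\<^bsub>M\<^esub> lincomb x t m" using lincomb_smult[of p m t x] t p x by simp
    finally show ?thesis using CI t by blast
  qed
  have pD: "p [^] Suc i \<odot>\<^bsub>M\<^esub> y \<in> D" if "y \<in> carrier M" for y using that by (auto simp: D_def)
  obtain N where N: "submodule N R M" "N \<inter> C = {\<zero>\<^bsub>M\<^esub>}"
    "\<And>y. y \<in> carrier M \<Longrightarrow> \<exists>n\<in>N. \<exists>c\<in>C. y = n \<oplus>\<^bsub>M\<^esub> c"
    using exists_complement[OF p C D DC pD pC] by blast
  note NE = submoduleE[OF N(1)] submodule_zero[OF N(1)]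
  have NM: "n \<in> carrier M" if "n \<in> N" for n using that NE(1) by auto
  \<comment> \<open>The images under the backward shift: \<open>x 0\<close> goes to zero and
    \<open>x (Suc j)\<close> to \<open>x j\<close>.\<close>
  define x' where "x' = case_nat \<zero>\<^bsub>M\<^esub> x"
  have x': "x' j \<in> carrier M" "p [^] Suc i \<odot>\<^bsub>M\<^esub> x' j = \<zero>\<^bsub>M\<^esub>" for j
    using x pi[of "Suc i"] by (cases j; simp add: x'_def)+
  \<comment> \<open>The graph of the identity on \<open>N\<close> plus the shift on
    \<open>C\<close>. Coefficients are determined only modulo \<open>p^(i+1)\<close>, hence a
    relation instead of a function.\<close>
  define G where "G = {(n \<oplus>\<^bsub>M\<^esub> lincomb x r m, n \<oplus>\<^bsub>M\<^esub> lincomb x' r m) | n r m.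
    n \<in> N \<and> (\<forall>j. r j \<in> carrier R)}"
  have GI: "(n \<oplus>\<^bsub>M\<^esub> lincomb x r m, n \<oplus>\<^bsub>M\<^esub> lincomb x' r m) \<in> G"
    if "n \<in> N" "\<And>j. r j \<in> carrier R" for n r m using that unfolding G_def by blast
  have lc: "lincomb x r m \<in> carrier M" "lincomb x' r m \<in> carrier M" if "\<forall>j. r j \<in> carrier R" for r m
    using that x(1) x'(1) by (auto intro!: lincomb_closed)
  obtain h where h: "h \<in> mod_hom R M M" "\<And>y z. (y, z) \<in> G \<Longrightarrow> h y = z"
  proof (rule mod_hom_of_graph[OF module_axioms, of G])
    show "G \<subseteq> carrier M \<times> carrier M" using lc NM unfolding G_def by auto
    show "(y \<oplus>\<^bsub>M\<^esub> y', z \<oplus>\<^bsub>M\<^esub> z') \<in> G" if yz: "(y, z) \<in> G" "(y', z') \<in> G" for y z y' z'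
    proof -
      obtain n r m where 1: "n \<in> N" "\<forall>j. r j \<in> carrier R"
        "y = n \<oplus>\<^bsub>M\<^esub> lincomb x r m" "z = n \<oplus>\<^bsub>M\<^esub> lincomb x' r m"
        using yz(1) unfolding G_def by blast
      obtain n' s k where 2: "n' \<in> N" "\<forall>j. s j \<in> carrier R"
        "y' = n' \<oplus>\<^bsub>M\<^esub> lincomb x s k" "z' = n' \<oplus>\<^bsub>M\<^esub> lincomb x' s k"
        using yz(2) unfolding G_def by blast
      obtain t l where t: "\<And>j. t j \<in> carrier R"
        "\<And>x. (\<And>j. x j \<in> carrier M) \<Longrightarrow> lincomb x t l = lincomb x r m \<oplus>\<^bsub>M\<^esub> lincomb x s k"
        using lincomb_add_pad[of m r k s] 1(2) 2(2) by blast
      have "y \<oplus>\<^bsub>M\<^esub> y' = (n \<oplus>\<^bsub>M\<^esub> n') \<oplus>\<^bsub>M\<^esub> lincomb x t l"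
        unfolding 1(3) 2(3) using t(2)[of x] x(1) NM 1 2 lc by (simp add: M.a_ac)
      moreover have "z \<oplus>\<^bsub>M\<^esub> z' = (n \<oplus>\<^bsub>M\<^esub> n') \<oplus>\<^bsub>M\<^esub> lincomb x' t l"
        unfolding 1(4) 2(4) using t(2)[of x'] x'(1) NM 1 2 lc by (simp add: M.a_ac)
      ultimately show ?thesis using GI[OF NE(5)[OF 1(1) 2(1)], of t l] t(1) by simp
    qed
    show "(a \<odot>\<^bsub>M\<^esub> y, a \<odot>\<^bsub>M\<^esub> z) \<in> G" if a: "a \<in> carrier R" "(y, z) \<in> G" for a y z
    proof -
      obtain n r m where 1: "n \<in> N" "\<forall>j. r j \<in> carrier R"
        "y = n \<oplus>\<^bsub>M\<^esub> lincomb x r m" "z = n \<oplus>\<^bsub>M\<^esub> lincomb x' r m"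
        using a(2) unfolding G_def by blast
      have "a \<odot>\<^bsub>M\<^esub> y = a \<odot>\<^bsub>M\<^esub> n \<oplus>\<^bsub>M\<^esub> lincomb x (\<lambda>j. a \<otimes> r j) m"
        unfolding 1(3) using a lincomb_smult[of a m r x] x(1) 1 lc NM by (simp add: smult_r_distr)
      moreover have "a \<odot>\<^bsub>M\<^esub> z = a \<odot>\<^bsub>M\<^esub> n \<oplus>\<^bsub>M\<^esub> lincomb x' (\<lambda>j. a \<otimes> r j) m"
        unfolding 1(4) using a lincomb_smult[of a m r x'] x'(1) 1 lc NM by (simp add: smult_r_distr)
      ultimately show ?thesis using GI[OF NE(4)[OF a(1) 1(1)], of "\<lambda>j. a \<otimes> r j" m] 1 a by simp
    qed
    show "\<exists>z. (y, z) \<in> G" if y: "y \<in> carrier M" for y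
    proof -
      obtain n c where "n \<in> N" "c \<in> C" "y = n \<oplus>\<^bsub>M\<^esub> c" using N(3)[OF y] by blast
      then show ?thesis using GI unfolding C_def by blast
    qed
    \<comment> \<open>Since \<open>N\<close> and \<open>C\<close> meet trivially, both summands of
      zero vanish. Then \<open>p^(i+1)\<close> divides the coefficients, which kills the shifted
      combination too.\<close>
    show "z = \<zero>\<^bsub>M\<^esub>" if z: "(\<zero>\<^bsub>M\<^esub>, z) \<in> G" for z
    proof -
      obtain n r m where 1: "n \<in> N" "\<forall>j. r j \<in> carrier R"
        "\<zero>\<^bsub>M\<^esub> = n \<oplus>\<^bsub>M\<^esub> lincomb x r m" "z = n \<oplus>\<^bsub>M\<^esub> lincomb x' r m"
        using z unfolding G_def by blast
      have "lincomb x r m = \<ominus>\<^bsub>M\<^esub> n"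
        using M.minus_equality[of "lincomb x r m" n] 1 lc NM M.a_comm by metis
      then have "lincomb x r m \<in> N" using NE(3) 1(1) by simp
      moreover have "lincomb x r m \<in> C" using CI 1(2) by blast
      ultimately have l0: "lincomb x r m = \<zero>\<^bsub>M\<^esub>" using N(2) by blast
      then have "n = \<zero>\<^bsub>M\<^esub>" using 1(3) NM[OF 1(1)] unfolding l0 by simp
      moreover have "lincomb x' r m = \<zero>\<^bsub>M\<^esub>"
      proof (rule kill[OF _ x'])
        show "\<forall>j<m. r j \<in> PIdl (p [^] Suc i)"
          by (rule coeff) (use 1 l0 submodule_zero[OF D] in auto)
      qed
      ultimately show ?thesis using 1(4) by simp
    qed
  qed blast
  have "h ` carrier M = carrier M"
  proof
    show "h ` carrier M \<subseteq> carrier M" using mod_homD(1)[OF h(1)] by blast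
    show "carrier M \<subseteq> h ` carrier M"
    proof
      fix y assume "y \<in> carrier M"
      then obtain n r m where y: "n \<in> N" "\<forall>j. r j \<in> carrier R" "y = n \<oplus>\<^bsub>M\<^esub> lincomb x r m"
        using N(3) unfolding C_def by blast
      \<comment> \<open>Moving every coefficient up by one index gives a preimage of
        \<open>y\<close>.\<close>
      let ?r = "case_nat \<zero> r"
      have r: "\<forall>j. ?r j \<in> carrier R" using y(2) by (auto split: nat.split)
      have "h (n \<oplus>\<^bsub>M\<^esub> lincomb x ?r (Suc m)) = n \<oplus>\<^bsub>M\<^esub> lincomb x' ?r (Suc m)"
        by (rule h(2), rule GI) (use y r in auto)
      also have "\<dots> = y" unfolding x'_def lincomb_shift y(3) ..
      finally have "y = h (n \<oplus>\<^bsub>M\<^esub> lincomb x ?r (Suc m))" ..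
      then show "y \<in> h ` carrier M" using NM[OF y(1)] lc(1)[OF r] by blast
    qed
  qed
  then have "inj_on h (carrier M)"
    using hopf h(1) unfolding hopfian_def mod_iso_def bij_betw_def by blast
  \<comment> \<open>Injectivity of \<open>h\<close> would give \<open>x 0 = 0\<close>, a combination
    in \<open>D\<close> with coefficient \<open>\<one>\<close>, so that \<open>\<one>\<close> would
    lie in \<open>(p)\<close>.\<close>
  moreover have "h (x 0) = \<zero>\<^bsub>M\<^esub>"
    using h(2)[OF GI[OF NE(7), of "\<lambda>_. \<one>" 1]] x by (simp add: x'_def)
  ultimately have "x 0 = \<zero>\<^bsub>M\<^esub>"
    using mod_hom_zero[OF module_axioms h(1)] x(1)[of 0] by (metis M.zero_closed inj_onD)
  then have "lincomb x (\<lambda>_. \<one>) 1 \<in> D" using submodule_zero[OF D] x(1)[of 0] by simp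
  then have "\<one> \<in> PIdl (p [^] Suc i)" using coeff[of "\<lambda>_. \<one>" 1] by simp
  then have "\<one> \<in> PIdl p" using p by (auto simp: R.mem_cgenideal_iff simp flip: R.m_assoc)
  then show False using R.one_notin_maximal[OF p(2)] by simp
qed

end

section \<open>From Hopfian to finitely generated\<close>

context artinian_pir_module
begin

text \<open>If \<open>V 0\<close>, the kernel of \<open>p\<close>, were not finitely generated, then
  no \<open>V i\<close> would be: a finitely generated \<open>V (Suc i)\<close> below a
  \<open>V i\<close> that is not yields an independent sequence, contradicting the Hopfian property.
  But \<open>V n\<close> is zero once the powers of \<open>p\<close> stabilise.\<close>

lemma hopfian_imp_kernel_fg:
  assumes hopf: "hopfian R M" and p: "p \<in> carrier R" "maximalideal (PIdl p) R"
  shows "fg_submodule {x \<in> carrier M. p \<odot>\<^bsub>M\<^esub> x = \<zero>\<^bsub>M\<^esub>}"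
proof (rule ccontr)
  assume not_fg: "\<not> ?thesis"
  define D where "D i = (\<lambda>y. p [^] (i::nat) \<odot>\<^bsub>M\<^esub> y) ` carrier M" for i
  define V where "V i = D i \<inter> {x \<in> carrier M. p \<odot>\<^bsub>M\<^esub> x = \<zero>\<^bsub>M\<^esub>}" for i
  have pi: "p [^] i \<in> carrier R" for i :: nat using p by simp
  have D: "submodule (D i) R M" for i
    unfolding D_def by (rule submodule_image[OF module_axioms smult_mod_hom[OF pi] carrier_is_submodule])
  have V: "submodule (V i) R M" for i
    unfolding V_def by (rule submodule_Int[OF D submodule_kernel[OF p(1)]])
  have DSuc: "D (Suc i) \<subseteq> D i" for i
  proof
    fix y assume "y \<in> D (Suc i)"
    then obtain z where "z \<in> carrier M" "y = p [^] i \<odot>\<^bsub>M\<^esub> (p \<odot>\<^bsub>M\<^esub> z)"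
      using p pi by (auto simp: D_def smult_assoc1)
    then show "y \<in> D i" using p by (auto simp: D_def)
  qed
  have "\<not> fg_submodule (V i)" for i
  proof (induction i)
    case 0
    have "D 0 = carrier M" by (auto simp: D_def image_iff)
    then have "V 0 = {x \<in> carrier M. p \<odot>\<^bsub>M\<^esub> x = \<zero>\<^bsub>M\<^esub>}" by (auto simp: V_def)
    then show ?case using not_fg by simp
  next
    case (Suc i)
    show ?case
    proof
      assume fg: "fg_submodule (V (Suc i))"
      have sub: "V (Suc i) \<subseteq> V i" using DSuc by (auto simp: V_def)
      have ann: "p \<odot>\<^bsub>M\<^esub> v = \<zero>\<^bsub>M\<^esub>" if "v \<in> V i" for v using that by (simp add: V_def)
      obtain v :: "nat \<Rightarrow> 'c" where v: "\<And>j. v j \<in> V i"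
        "\<And>r m. (\<And>j. r j \<in> carrier R) \<Longrightarrow> lincomb v r m \<in> V (Suc i) \<Longrightarrow> \<forall>j<m. r j \<in> PIdl p"
        using exists_independent_sequence[OF p V ann Suc fg sub] by blast
      have "\<forall>j. \<exists>y\<in>carrier M. v j = p [^] i \<odot>\<^bsub>M\<^esub> y" using v(1) by (auto simp: V_def D_def)
      then obtain x where x: "\<And>j. x j \<in> carrier M" "\<And>j. v j = p [^] i \<odot>\<^bsub>M\<^esub> x j" by metis
      have "\<not> hopfian R M"
      proof (rule independent_imp_not_hopfian[OF p, of x i])
        show "x j \<in> carrier M" for j by (rule x(1))
        show "p [^] Suc i \<odot>\<^bsub>M\<^esub> x j = \<zero>\<^bsub>M\<^esub>" for j
          unfolding pow_smult_Suc[OF p(1) x(1)] x(2)[symmetric] by (rule ann[OF v(1)])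
        fix s m assume s: "\<And>j. s j \<in> carrier R"
          and l: "lincomb (\<lambda>j. p [^] i \<odot>\<^bsub>M\<^esub> x j) s m \<in> (\<lambda>y. p [^] Suc i \<odot>\<^bsub>M\<^esub> y) ` carrier M"
        have eq: "(\<lambda>j. p [^] i \<odot>\<^bsub>M\<^esub> x j) = v" using x(2) by auto
        \<comment> \<open>The sequence is independent modulo \<open>V (Suc i)\<close>, while
          independence modulo all of \<open>p^(i+1) M\<close> is required. Combinations of the
          \<open>v j\<close> are killed by \<open>p\<close>, so the two agree.\<close>
        have "lincomb v s m \<in> V i" by (rule lincomb_in_submodule[OF V]) (use s v in auto)
        then have "lincomb v s m \<in> V (Suc i)" using l unfolding eq by (auto simp: V_def D_def)
        then show "\<forall>j<m. s j \<in> PIdl p" using v(2) s by blast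
      qed
      then show False using hopf by simp
    qed
  qed
  moreover obtain n u where nu: "u \<in> carrier R" "p [^] (n::nat) = u \<otimes> (p \<otimes> p [^] n)"
    using power_stabilises[OF p(1)] by blast
  have "x = \<zero>\<^bsub>M\<^esub>" if "x \<in> V n" for x
  proof -
    have px: "x \<in> D n" "p \<odot>\<^bsub>M\<^esub> x = \<zero>\<^bsub>M\<^esub>" using that by (auto simp: V_def)
    then obtain y where y: "y \<in> carrier M" "x = p [^] n \<odot>\<^bsub>M\<^esub> y" by (auto simp: D_def)
    have "x = (u \<otimes> (p \<otimes> p [^] n)) \<odot>\<^bsub>M\<^esub> y"
      unfolding y(2) by (rule arg_cong[OF nu(2), where f = "\<lambda>a. a \<odot>\<^bsub>M\<^esub> y"])
    also have "\<dots> = u \<odot>\<^bsub>M\<^esub> (p \<odot>\<^bsub>M\<^esub> x)" using y nu(1) p pi by (simp add: smult_assoc1)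
    finally show ?thesis using px(2) nu(1) by simp
  qed
  then have "V n = {\<zero>\<^bsub>M\<^esub>}" using submodule_zero[OF V] by blast
  ultimately show False using fg_zero by metis
qed

lemma bi_hopfian_iff_fg: "bi_hopfian R M \<longleftrightarrow> fg_submodule (carrier M)"
  using fg_imp_bi_hopfian fg_if_kernels_fg hopfian_imp_kernel_fg unfolding bi_hopfian_def by blast

end

section \<open>Essential extensions and the injective envelope\<close>

text \<open>If \<open>x\<close> is nonzero and \<open>p x = 0\<close>, essentiality gives a nonzero
  \<open>y = r x\<close> in the image. Then \<open>r\<close> is not in \<open>(p)\<close>, and
  inverting it modulo \<open>p\<close> gives \<open>x = a y\<close>, which is again in the
  image.\<close>

lemma essential_embedding_kernel:
  assumes "module R M" "module R E" and ess: "essential_embedding R M E \<iota>"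
    and p: "p \<in> carrier R" "maximalideal (PIdl\<^bsub>R\<^esub> p) R"
  shows "{x \<in> carrier E. p \<odot>\<^bsub>E\<^esub> x = \<zero>\<^bsub>E\<^esub>} = \<iota> ` {x \<in> carrier M. p \<odot>\<^bsub>M\<^esub> x = \<zero>\<^bsub>M\<^esub>}"
proof -
  interpret M: module R M by fact
  interpret E: module R E by fact
  have \<iota>: "\<iota> \<in> mod_hom R M E" "inj_on \<iota> (carrier M)"
    and essD: "\<And>N. submodule N R E \<Longrightarrow> N \<noteq> {\<zero>\<^bsub>E\<^esub>} \<Longrightarrow> N \<inter> \<iota> ` carrier M \<noteq> {\<zero>\<^bsub>E\<^esub>}"
    using ess unfolding essential_embedding_def by auto
  note \<iota>z = M.mod_hom_zero[OF assms(2) \<iota>(1)]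
  note sm\<iota> = M.submodule_image[OF assms(2) \<iota>(1) M.carrier_is_submodule]
  show ?thesis
  proof
    show "\<iota> ` {x \<in> carrier M. p \<odot>\<^bsub>M\<^esub> x = \<zero>\<^bsub>M\<^esub>} \<subseteq> {x \<in> carrier E. p \<odot>\<^bsub>E\<^esub> x = \<zero>\<^bsub>E\<^esub>}"
      using mod_homD(1)[OF \<iota>(1)] mod_homD(3)[OF \<iota>(1) p(1), symmetric] \<iota>z by auto
    show "{x \<in> carrier E. p \<odot>\<^bsub>E\<^esub> x = \<zero>\<^bsub>E\<^esub>} \<subseteq> \<iota> ` {x \<in> carrier M. p \<odot>\<^bsub>M\<^esub> x = \<zero>\<^bsub>M\<^esub>}"
    proof
      fix x assume "x \<in> {x \<in> carrier E. p \<odot>\<^bsub>E\<^esub> x = \<zero>\<^bsub>E\<^esub>}"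
      then have x: "x \<in> carrier E" "p \<odot>\<^bsub>E\<^esub> x = \<zero>\<^bsub>E\<^esub>" by auto
      have "x \<in> \<iota> ` carrier M"
      proof (cases "x = \<zero>\<^bsub>E\<^esub>")
        case True
        then show ?thesis using E.submodule_zero[OF sm\<iota>] by simp
      next
        case False
        \<comment> \<open>The cyclic submodule \<open>R x\<close>.\<close>
        let ?N = "E.adjoin {\<zero>\<^bsub>E\<^esub>} x"
        note N = E.submodule_adjoin[OF E.submodule_zero_set x(1)]
        have "?N \<noteq> {\<zero>\<^bsub>E\<^esub>}" using E.adjoin_self[OF E.submodule_zero_set x(1)] False by auto
        then obtain y where y: "y \<in> ?N" "y \<in> \<iota> ` carrier M" "y \<noteq> \<zero>\<^bsub>E\<^esub>"
          using essD[OF N] E.submodule_zero[OF N] E.submodule_zero[OF sm\<iota>] by blast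
        then obtain r where r: "r \<in> carrier R" "y = r \<odot>\<^bsub>E\<^esub> x" using x(1) by (auto simp: E.adjoin_def)
        have "r \<notin> PIdl\<^bsub>R\<^esub> p"
        proof
          assume "r \<in> PIdl\<^bsub>R\<^esub> p"
          then obtain s where "s \<in> carrier R" "r = s \<otimes>\<^bsub>R\<^esub> p" by (auto simp: M.R.mem_cgenideal_iff)
          then show False using y r x p by (simp add: E.smult_assoc1)
        qed
        then obtain a b where ab: "a \<in> carrier R" "b \<in> carrier R" "a \<otimes>\<^bsub>R\<^esub> r \<oplus>\<^bsub>R\<^esub> b \<otimes>\<^bsub>R\<^esub> p = \<one>\<^bsub>R\<^esub>"
          using M.R.maximal_cgenideal_bezout[OF p r(1)] by blast
        have "x = (a \<otimes>\<^bsub>R\<^esub> r \<oplus>\<^bsub>R\<^esub> b \<otimes>\<^bsub>R\<^esub> p) \<odot>\<^bsub>E\<^esub> x" using ab x by simp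
        also have "\<dots> = a \<odot>\<^bsub>E\<^esub> y" using ab(1,2) r x p by (simp add: E.smult_l_distr E.smult_assoc1)
        finally show ?thesis using E.submoduleE(4)[OF sm\<iota> ab(1) y(2)] by simp
      qed
      then obtain m where m: "m \<in> carrier M" "x = \<iota> m" by blast
      then have "\<iota> (p \<odot>\<^bsub>M\<^esub> m) = \<iota> \<zero>\<^bsub>M\<^esub>" using mod_homD(3)[OF \<iota>(1) p(1) m(1)] x \<iota>z by simp
      then have "p \<odot>\<^bsub>M\<^esub> m = \<zero>\<^bsub>M\<^esub>" using inj_onD[OF \<iota>(2)] m p by auto
      then show "x \<in> \<iota> ` {x \<in> carrier M. p \<odot>\<^bsub>M\<^esub> x = \<zero>\<^bsub>M\<^esub>}" using m by blast
    qed
  qed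
qed

theorem theorem3p9:
  fixes R :: "('a, 'm) ring_scheme" and M :: "('a, 'b, 'n) module_scheme"
  assumes "artinian_cring R" and "principal_ideal_cring R" and "\<one>\<^bsub>R\<^esub> \<noteq> \<zero>\<^bsub>R\<^esub>"
    and "module R M"
  shows "(bi_hopfian R M \<longleftrightarrow> finitely_generated R M) \<and>
    (\<forall>(E :: ('a, 'e, 'k) module_scheme) \<iota>. injective_envelope R M E \<iota> \<longrightarrow>
      (bi_hopfian R M \<longleftrightarrow> bi_hopfian R E))"
proof (intro conjI allI impI)
  interpret M: artinian_pir_module R M
    using assms by (intro artinian_pir_module.intro artinian_pir.intro)
  show "bi_hopfian R M \<longleftrightarrow> finitely_generated R M"
    by (simp add: M.bi_hopfian_iff_fg M.finitely_generated_iff_fg_submodule)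
  fix E :: "('a, 'e, 'k) module_scheme" and \<iota>
  assume "injective_envelope R M E \<iota>"
  then have mE: "module R E" and ess: "essential_embedding R M E \<iota>"
    unfolding injective_envelope_def injective_module_def injective_wrt_def by auto
  interpret E: artinian_pir_module R E
    using assms mE by (intro artinian_pir_module.intro artinian_pir.intro)
  have \<iota>: "\<iota> \<in> mod_hom R M E" "inj_on \<iota> (carrier M)"
    using ess unfolding essential_embedding_def by auto
  \<comment> \<open>By the kernel criterion only the kernels of generators of maximal ideals in
    \<open>E\<close> matter. They are images of the corresponding kernels in \<open>M\<close>, which
    are finitely generated as submodules of \<open>M\<close>.\<close>
  have "E.fg_submodule (carrier E)" if "M.fg_submodule (carrier M)"
  proof (rule E.fg_if_kernels_fg)
    fix p assume p: "p \<in> carrier R" "maximalideal (PIdl\<^bsub>R\<^esub> p) R"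
    have "M.fg_submodule {x \<in> carrier M. p \<odot>\<^bsub>M\<^esub> x = \<zero>\<^bsub>M\<^esub>}"
      by (rule M.fg_submodule_subset[OF that M.submodule_kernel[OF p(1)]]) auto
    then show "E.fg_submodule {x \<in> carrier E. p \<odot>\<^bsub>E\<^esub> x = \<zero>\<^bsub>E\<^esub>}"
      unfolding essential_embedding_kernel[OF assms(4) mE ess p]
      by (rule M.fg_submodule_image[OF mE \<iota>(1)])
  qed
  \<comment> \<open>Conversely, \<open>M\<close> is isomorphic to its image, a submodule of the
    finitely generated module \<open>E\<close>.\<close>
  moreover have "M.fg_submodule (carrier M)" if "E.fg_submodule (carrier E)"
  proof (rule M.fg_submodule_extension[OF mE \<iota>(1) _ M.carrier_is_submodule refl])
    show "E.fg_submodule (\<iota> ` carrier M)"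
      using mod_homD(1)[OF \<iota>(1)]
      by (intro E.fg_submodule_subset[OF that]
          M.submodule_image[OF mE \<iota>(1) M.carrier_is_submodule]) auto
    have "{x \<in> carrier M. \<iota> x = \<zero>\<^bsub>E\<^esub>} = {\<zero>\<^bsub>M\<^esub>}"
    proof -
      have "x = \<zero>\<^bsub>M\<^esub>" if "x \<in> carrier M" "\<iota> x = \<zero>\<^bsub>E\<^esub>" for x
        using inj_onD[OF \<iota>(2), of x "\<zero>\<^bsub>M\<^esub>"] that M.mod_hom_zero[OF mE \<iota>(1)] by simp
      then show ?thesis using M.mod_hom_zero[OF mE \<iota>(1)] M.M.zero_closed by blast
    qed
    then show "M.fg_submodule {x \<in> carrier M. \<iota> x = \<zero>\<^bsub>E\<^esub>}" using M.fg_zero by simp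
  qed
  ultimately show "bi_hopfian R M \<longleftrightarrow> bi_hopfian R E"
    unfolding M.bi_hopfian_iff_fg E.bi_hopfian_iff_fg by blast
qed

end
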